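(* Let $R$ be a commutative unital ring and let $I$ be a two-generated ideal of $R$ such that $\mathrm{Fitt}_1(I) = I I^{-1}$; this hypothesis holds for example if $I$ is generated by two regular elements. Then the determinant map $(a,b)\mapsto a\wedge b$ induces an injection from the orbit set $V_2(I)/\mathrm{SL}_2(R)$ into $V_1(\bigwedge^2 I)\simeq (R/\mathrm{Fitt}_1(I))^{\times}$.
   Context: Rings are commutative with identity. An ideal is two-generated if it can be generated by two elements. An element of $R$ is regular if it is not a zero divisor; $K(R)$ is the total ring of quotients of $R$ (localization at the set of regular elements), and $I^{-1}=\{x\in K(R) : xI\subseteq R\}$. For a finitely generated $R$-module $M$, $V_n(M)$ is the set of $n$-tuples in $M^n$ whose components generate $M$; $\mathrm{GL}_n(R)$ and its subgroup $\mathrm{SL}_n(R)$ (determinant $1$ matrices) act on $V_n(M)$ by right multiplication of row vectors by matrices. Fitting ideals: if $F\xrightarrow{\varphi} G\to M\to 0$ is exact with $F,G$ free and $G$ of finite rank $g$, then $\mathrm{Fitt}_i(M)$ is the ideal generated by the $(g-i)\times(g-i)$ minors of a matrix of $\varphi$ (with the convention that the ideal of $0\times 0$ minors is $R$). For $I$ two-generated, $\det(I)=\bigwedge^2 I$ is a cyclic $R$-module with annihilator $\mathrm{Fitt}_1(I)$; so for a fixed $(m_1,m_2)\in V_2(I)$, the map $u\mapsto u\,(m_1\wedge m_2)$ identifies $(R/\mathrm{Fitt}_1(I))^\times$ with $V_1(\bigwedge^2 I)$. The determinant map $V_2(I)\to V_1(\bigwedge^2 I)$ is $(a,b)\mapsto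 a\wedge b$. *)

theory Defs
  imports
    "HOL-Library.Poly_Mapping"
    "Jordan_Normal_Form.Determinant"
begin

section \<open>The total ring of quotients\<close>

definition regular :: "'a::comm_ring_1 \<Rightarrow> bool"
  where "regular s \<longleftrightarrow> (\<forall>y. s * y = 0 \<longrightarrow> y = 0)"

lemma regular_1 [simp]: "regular 1"
  by (simp add: regular_def)

lemma regular_mult: "regular s \<Longrightarrow> regular t \<Longrightarrow> regular (s * t)"
  unfolding regular_def mult.assoc by blast

lemma regular_cancel: "regular s \<Longrightarrow> s * x = s * y \<Longrightarrow> x = y"
proof -
  assume s: "regular s" and e: "s * x = s * y"
  have "s * (x - y) = 0"
    using e by (simp add: right_diff_distrib)
  then have "x - y = 0"
    using s unfolding regular_def by blast
  then show "x = y" by simp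
qed

text \<open>Pairs \<open>(a, s)\<close> with \<open>s\<close> regular represent the fraction \<open>a / s\<close>. As the denominators are
  regular, the usual auxiliary factor in the equality of fractions can be cancelled.\<close>

definition quotrel :: "'a::comm_ring_1 \<times> 'a \<Rightarrow> 'a \<times> 'a \<Rightarrow> bool"
  where "quotrel x y \<longleftrightarrow> regular (snd x) \<and> regular (snd y) \<and> fst x * snd y = fst y * snd x"

lemma part_equivp_quotrel: "part_equivp (quotrel :: 'a::comm_ring_1 \<times> 'a \<Rightarrow> _)"
proof (rule part_equivpI)
  show "\<exists>x. quotrel x (x :: 'a \<times> 'a)"
    by (rule exI[of _ "(0, 1)"]) (simp add: quotrel_def)
  show "symp (quotrel :: 'a \<times> 'a \<Rightarrow> _)"
    by (auto simp: symp_def quotrel_def)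
  show "transp (quotrel :: 'a \<times> 'a \<Rightarrow> _)"
  proof (rule transpI)
    fix x y z :: "'a \<times> 'a"
    assume xy: "quotrel x y" and yz: "quotrel y z"
    have e: "fst x * snd y = fst y * snd x" "fst y * snd z = fst z * snd y"
      using xy yz by (simp_all add: quotrel_def)
    have "snd y * (fst x * snd z) = (fst x * snd y) * snd z" by (simp only: ac_simps)
    also have "\<dots> = (fst y * snd z) * snd x" by (subst e(1)) (simp only: ac_simps)
    also have "\<dots> = snd y * (fst z * snd x)" by (subst e(2)) (simp only: ac_simps)
    finally have "snd y * (fst x * snd z) = snd y * (fst z * snd x)" .
    moreover have "regular (snd y)"
      using xy by (simp add: quotrel_def)
    ultimately have "fst x * snd z = fst z * snd x"
      by (rule regular_cancel[rotated])
    then show "quotrel x z"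
      using xy yz by (simp add: quotrel_def)
  qed
qed

quotient_type (overloaded) 'a total_quot = "'a::comm_ring_1 \<times> 'a" / partial: "quotrel"
  by (rule part_equivp_quotrel)

instantiation total_quot :: (comm_ring_1) comm_ring_1
begin

lift_definition zero_total_quot :: "'a total_quot" is "(0, 1)"
  by (simp add: quotrel_def)

lift_definition one_total_quot :: "'a total_quot" is "(1, 1)"
  by (simp add: quotrel_def)

lift_definition plus_total_quot :: "'a total_quot \<Rightarrow> 'a total_quot \<Rightarrow> 'a total_quot"
  is "\<lambda>x y. (fst x * snd y + fst y * snd x, snd x * snd y)"
proof -
  fix x x' y y' :: "'a \<times> 'a"
  assume x: "quotrel x x'" and y: "quotrel y y'"
  have "(fst x * snd y + fst y * snd x) * (snd x' * snd y')
      = (fst x * snd x') * snd y * snd y' + (fst y * snd y') * snd x * snd x'"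
    by (simp add: algebra_simps)
  also have "\<dots> = (fst x' * snd x) * snd y * snd y' + (fst y' * snd y) * snd x * snd x'"
    using x y by (simp add: quotrel_def)
  also have "\<dots> = (fst x' * snd y' + fst y' * snd x') * (snd x * snd y)"
    by (simp add: algebra_simps)
  finally show "quotrel (fst x * snd y + fst y * snd x, snd x * snd y)
      (fst x' * snd y' + fst y' * snd x', snd x' * snd y')"
    using x y by (simp add: quotrel_def regular_mult)
qed

lift_definition uminus_total_quot :: "'a total_quot \<Rightarrow> 'a total_quot"
  is "\<lambda>x. (- fst x, snd x)"
  by (simp add: quotrel_def)

definition minus_total_quot :: "'a total_quot \<Rightarrow> 'a total_quot \<Rightarrow> 'a total_quot"
  where "minus_total_quot x y = x + - y"

lift_definition times_total_quot :: "'a total_quot \<Rightarrow> 'a total_quot \<Rightarrow> 'a total_quot"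
  is "\<lambda>x y. (fst x * fst y, snd x * snd y)"
proof -
  fix x x' y y' :: "'a \<times> 'a"
  assume x: "quotrel x x'" and y: "quotrel y y'"
  have "(fst x * fst y) * (snd x' * snd y') = (fst x * snd x') * (fst y * snd y')"
    by (simp only: ac_simps)
  also have "\<dots> = (fst x' * snd x) * (fst y' * snd y)"
    using x y by (simp add: quotrel_def)
  also have "\<dots> = (fst x' * fst y') * (snd x * snd y)"
    by (simp only: ac_simps)
  finally show "quotrel (fst x * fst y, snd x * snd y) (fst x' * fst y', snd x' * snd y')"
    using x y by (simp add: quotrel_def regular_mult)
qed

instance
proof
  fix x y z :: "'a total_quot"
  show "(x * y) * z = x * (y * z)"
    by transfer (auto simp: quotrel_def regular_mult algebra_simps)
  show "x * y = y * x"
    by transfer (auto simp: quotrel_def regular_mult algebra_simps)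
  show "1 * x = x"
    by transfer (auto simp: quotrel_def)
  show "(x + y) + z = x + (y + z)"
    by transfer (auto simp: quotrel_def regular_mult algebra_simps)
  show "x + y = y + x"
    by transfer (auto simp: quotrel_def regular_mult algebra_simps)
  show "0 + x = x"
    by transfer (auto simp: quotrel_def)
  show "- x + x = 0"
    by transfer (auto simp: quotrel_def regular_mult algebra_simps)
  show "x - y = x + - y"
    by (fact minus_total_quot_def)
  show "(x + y) * z = x * z + y * z"
    by transfer (auto simp: quotrel_def regular_mult algebra_simps)
  show "(0 :: 'a total_quot) \<noteq> 1"
    by transfer (simp add: quotrel_def)
qed

end

lift_definition to_quot :: "'a::comm_ring_1 \<Rightarrow> 'a total_quot" is "\<lambda>a. (a, 1)"
  by (simp add: quotrel_def)

lemma to_quot_hom: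
  "to_quot (a + b) = to_quot a + to_quot b"
  "to_quot (a * b) = to_quot a * to_quot b"
  "to_quot 1 = 1"
  by (transfer; simp add: quotrel_def)+

section \<open>Ideals and submodules\<close>

text \<open>A module is given by a scalar multiplication on a type together with a submodule
  (\<open>subspace\<close> in the library) of it. The ideals of \<open>R\<close> are the submodules \<open>ring_mod.subspace\<close>
  of \<open>R\<close>, and \<open>ring_mod.span S\<close> is the ideal generated by \<open>S\<close>.\<close>

interpretation ring_mod: Modules.module "(*) :: 'a::comm_ring_1 \<Rightarrow> 'a \<Rightarrow> 'a"
  by standard (simp_all add: distrib_left distrib_right mult.assoc)

declare ring_mod.scale_scale [simp del]

interpretation quot_mod: Modules.module "\<lambda>(r :: 'a::comm_ring_1) x. to_quot r * x"
  by standard (simp_all add: to_quot_hom distrib_left distrib_right mult.assoc)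

text \<open>The free module on a type \<open>'b\<close>; the free module on a set \<open>B\<close> is the submodule
  of all \<open>p\<close> with \<open>Poly_Mapping.keys p \<subseteq> B\<close>.\<close>

definition free_scale :: "'a::comm_ring_1 \<Rightarrow> ('b \<Rightarrow>\<^sub>0 'a) \<Rightarrow> ('b \<Rightarrow>\<^sub>0 'a)"
  where "free_scale r = Poly_Mapping.map ((*) r)"

lemma lookup_free_scale [simp]: "Poly_Mapping.lookup (free_scale r p) i = r * Poly_Mapping.lookup p i"
  by (simp add: free_scale_def Poly_Mapping.map.rep_eq when_def)

interpretation free_mod: Modules.module "free_scale :: 'a::comm_ring_1 \<Rightarrow> ('b \<Rightarrow>\<^sub>0 'a) \<Rightarrow> _"
  by standard (simp_all add: poly_mapping_eq_iff fun_eq_iff lookup_add distrib_left distrib_right mult.assoc)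

definition two_generated :: "'a::comm_ring_1 set \<Rightarrow> bool"
  where "two_generated I \<longleftrightarrow> (\<exists>a b. I = ring_mod.span {a, b})"

definition ideal_inverse :: "'a::comm_ring_1 set \<Rightarrow> 'a total_quot set"
  where "ideal_inverse I = {x. \<forall>a\<in>I. x * to_quot a \<in> range to_quot}"

text \<open>The product \<open>I I\<^sup>-\<^sup>1\<close>, formed inside the total ring of quotients.\<close>

definition ideal_times_inverse :: "'a::comm_ring_1 set \<Rightarrow> 'a total_quot set"
  where "ideal_times_inverse I =
    quot_mod.span {to_quot a * x | a x. a \<in> I \<and> x \<in> ideal_inverse I}"

section \<open>Minors\<close>

text \<open>The ideal generated by the \<open>k \<times> k\<close> minors of the matrix with rows indexed by \<open>{..<g}\<close> and
  set of columns \<open>\<Phi>\<close>. The set may be infinite. Repeated columns do not matter, because a minor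
  with two equal columns vanishes; the order of the columns only affects signs.\<close>

definition minor_ideal :: "nat \<Rightarrow> nat \<Rightarrow> (nat \<Rightarrow>\<^sub>0 'a::comm_ring_1) set \<Rightarrow> 'a set"
  where "minor_ideal k g \<Phi> = ring_mod.span
    {det (mat k k (\<lambda>(i, j). Poly_Mapping.lookup (c j) (r i))) | r c.
       strict_mono_on {..<k} r \<and> r ` {..<k} \<subseteq> {..<g} \<and>
       inj_on c {..<k} \<and> c ` {..<k} \<subseteq> \<Phi>}"

section \<open>Generating tuples, Fitting ideals and exterior squares\<close>

locale comm_module = Modules.module scale
  for scale :: "'a::comm_ring_1 \<Rightarrow> 'b::ab_group_add \<Rightarrow> 'b"
begin

text \<open>\<open>V n M\<close> is the set of \<open>n\<close>-tuples generating \<open>M\<close>; the components lie in \<open>M\<close> since they lie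
  in their span.\<close>

definition V :: "nat \<Rightarrow> 'b set \<Rightarrow> 'b vec set"
  where "V n M = {m \<in> carrier_vec n. span (set\<^sub>v m) = M}"

text \<open>The row vector \<open>m\<close> times the matrix \<open>A\<close>.\<close>

definition row_mult :: "'b vec \<Rightarrow> 'a mat \<Rightarrow> 'b vec"
  where "row_mult m A = vec (dim_col A) (\<lambda>j. \<Sum>i<dim_row A. scale (A $$ (i, j)) (m $ i))"

definition SL_orbit :: "'b vec \<Rightarrow> 'b vec set"
  where "SL_orbit m = {row_mult m A | A. A \<in> carrier_mat (dim_vec m) (dim_vec m) \<and> det A = 1}"

text \<open>For a tuple \<open>m\<close> of \<open>g\<close> elements, \<open>relations m\<close> is the kernel of the map \<open>G \<rightarrow> M\<close> sending the
  basis of the free module \<open>G\<close> on \<open>{..<g}\<close> to \<open>m\<close>. The exact sequence \<open>F \<rightarrow> G \<rightarrow> M \<rightarrow> 0\<close> is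
  recorded by \<open>m\<close> and the set \<open>\<Phi>\<close> of the images in \<open>G\<close> of the basis elements of \<open>F\<close>, that is, of
  the columns of the matrix of \<open>F \<rightarrow> G\<close>.\<close>

definition relations :: "'b vec \<Rightarrow> (nat \<Rightarrow>\<^sub>0 'a) set"
  where "relations m = {v. Poly_Mapping.keys v \<subseteq> {..<dim_vec m} \<and>
    (\<Sum>i<dim_vec m. scale (Poly_Mapping.lookup v i) (m $ i)) = 0}"

definition free_presentation :: "'b set \<Rightarrow> nat \<Rightarrow> 'b vec \<Rightarrow> (nat \<Rightarrow>\<^sub>0 'a) set \<Rightarrow> bool"
  where "free_presentation M g m \<Phi> \<longleftrightarrow> m \<in> V g M \<and> free_mod.span \<Phi> = relations m"

text \<open>The ideal is independent of the presentation (Fitting's lemma). For \<open>i > g\<close> the truncated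
  subtraction gives \<open>0 \<times> 0\<close> minors, hence the whole ring.\<close>

definition fitting_ideal :: "nat \<Rightarrow> 'b set \<Rightarrow> 'a set"
  where "fitting_ideal i M =
    (THE J. \<exists>g m \<Phi>. free_presentation M g m \<Phi> \<and> J = minor_ideal (g - i) g \<Phi>)"

text \<open>The exterior square of \<open>M\<close> is the free module on \<open>M \<times> M\<close> modulo the relations making
  \<open>(x, y) \<mapsto> x \<and> y\<close> bilinear and alternating. Its elements are cosets.\<close>

abbreviation (input) pair :: "'b \<Rightarrow> 'b \<Rightarrow> ('b \<times> 'b) \<Rightarrow>\<^sub>0 'a"
  where "pair x y \<equiv> Poly_Mapping.single (x, y) 1"

definition ext2_relations :: "'b set \<Rightarrow> (('b \<times> 'b) \<Rightarrow>\<^sub>0 'a) set"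
  where "ext2_relations M = free_mod.span
    ({pair (x + x') y - pair x y - pair x' y | x x' y. x \<in> M \<and> x' \<in> M \<and> y \<in> M} \<union>
     {pair x (y + y') - pair x y - pair x y' | x y y'. x \<in> M \<and> y \<in> M \<and> y' \<in> M} \<union>
     {pair (scale r x) y - free_scale r (pair x y) | r x y. x \<in> M \<and> y \<in> M} \<union>
     {pair x (scale r y) - free_scale r (pair x y) | r x y. x \<in> M \<and> y \<in> M} \<union>
     {pair x x | x. x \<in> M})"

definition ext2_class :: "'b set \<Rightarrow> (('b \<times> 'b) \<Rightarrow>\<^sub>0 'a) \<Rightarrow> (('b \<times> 'b) \<Rightarrow>\<^sub>0 'a) set"
  where "ext2_class M p = {q. q - p \<in> ext2_relations M}"

definition ext2 :: "'b set \<Rightarrow> (('b \<times> 'b) \<Rightarrow>\<^sub>0 'a) set set"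
  where "ext2 M = {ext2_class M p | p. Poly_Mapping.keys p \<subseteq> M \<times> M}"

definition wedge :: "'b set \<Rightarrow> 'b \<Rightarrow> 'b \<Rightarrow> (('b \<times> 'b) \<Rightarrow>\<^sub>0 'a) set"
  where "wedge M x y = ext2_class M (pair x y)"

definition ext2_scale ::
    "'b set \<Rightarrow> 'a \<Rightarrow> (('b \<times> 'b) \<Rightarrow>\<^sub>0 'a) set \<Rightarrow> (('b \<times> 'b) \<Rightarrow>\<^sub>0 'a) set"
  where "ext2_scale M r \<omega> = (\<Union>p\<in>\<omega>. ext2_class M (free_scale r p))"

text \<open>The set \<open>V\<^sub>1\<close> of the exterior square of \<open>M\<close>: its single generators.\<close>

definition V1_ext2 :: "'b set \<Rightarrow> (('b \<times> 'b) \<Rightarrow>\<^sub>0 'a) set set"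
  where "V1_ext2 M = {\<omega> \<in> ext2 M. {ext2_scale M r \<omega> | r. True} = ext2 M}"

end

interpretation ring_mod: comm_module "(*) :: 'a::comm_ring_1 \<Rightarrow> 'a \<Rightarrow> 'a"
  by unfold_locales

section \<open>Units of a residue ring\<close>

definition residue :: "'a::comm_ring_1 set \<Rightarrow> 'a \<Rightarrow> 'a set"
  where "residue J r = {s. s - r \<in> J}"

text \<open>The units of \<open>R / J\<close>: the residue \<open>r + J\<close> is a unit if \<open>(r + J) (s + J) = 1 + J\<close> for
  some \<open>s\<close>.\<close>

definition residue_units :: "'a::comm_ring_1 set \<Rightarrow> 'a set set"
  where "residue_units J = {residue J r | r. \<exists>s. residue J (r * s) = residue J 1}"

end

theory Submission
  imports Defs
begin

text \<open>Everything is computed from a pair \<open>(a, b)\<close> of generators of \<open>I\<close>. The coefficients of the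
  relations \<open>x a + y b = 0\<close> generate \<open>Fitt\<^sub>1(I)\<close>, and they also generate the annihilator of \<open>a \<and> b\<close>
  in the exterior square; this identifies the generators of the exterior square with the units
  modulo \<open>Fitt\<^sub>1(I)\<close>. If \<open>(c, d) = (a, b) A\<close> is another generating pair with the same wedge, then
  \<open>det A - 1 \<in> Fitt\<^sub>1(I) = I I\<^sup>-\<^sup>1\<close>, and the columns of \<open>A\<close> can be changed by relations of the form
  \<open>(b z, - a z)\<close> with \<open>z \<in> I\<^sup>-\<^sup>1\<close> so that the determinant becomes \<open>1\<close>.

  That \<open>Fitt\<^sub>1\<close> does not depend on the presentation is shown by describing it without a choice of
  rows: for generators \<open>m\<close>, it is generated by the determinants of the square matrices \<open>A\<close> such that
  \<open>m A\<close> has at most one nonzero entry.\<close>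

section \<open>Fitting's lemma for the first Fitting ideal\<close>

text \<open>Expansion along the first row leaves a single term each time, so the block below the
  identity may be arbitrary. This evaluates the determinant of the block matrix \<open>L\<close> in
  \<open>rel_dets_mono\<close>.\<close>

lemma det_identity_rows:
  fixes B :: "'a::comm_ring_1 mat"
  assumes "B \<in> carrier_mat (n + k) (n + k)"
    and "\<And>i j. i < n \<Longrightarrow> j < n + k \<Longrightarrow> B $$ (i, j) = (if i = j then 1 else 0)"
  shows "det B = det (mat k k (\<lambda>(i, j). B $$ (n + i, n + j)))"
  using assms
proof (induction n arbitrary: B)
  case 0
  then have "B = mat k k (\<lambda>(i, j). B $$ (i, j))"
    by (intro eq_matI) auto
  then show ?case by simp
next
  case (Suc n)
  let ?C = "mat_delete B 0 0"
  have "det B = (\<Sum>j<Suc n + k. B $$ (0, j) * cofactor B 0 j)"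
    by (rule laplace_expansion_row[OF Suc.prems(1)]) simp
  also have "\<dots> = (\<Sum>j<Suc n + k. if j = 0 then cofactor B 0 0 else 0)"
    by (rule sum.cong) (auto simp: Suc.prems(2))
  also have "\<dots> = det ?C"
    by (simp add: cofactor_def)
  also have "\<dots> = det (mat k k (\<lambda>(i, j). ?C $$ (n + i, n + j)))"
  proof (rule Suc.IH)
    show "?C \<in> carrier_mat (n + k) (n + k)"
      using mat_delete_carrier[OF Suc.prems(1), of 0 0] by simp
    show "?C $$ (i, j) = (if i = j then 1 else 0)" if "i < n" "j < n + k" for i j
      using that Suc.prems by (simp add: mat_delete_def)
  qed
  also have "mat k k (\<lambda>(i, j). ?C $$ (n + i, n + j)) = mat k k (\<lambda>(i, j). B $$ (Suc n + i, Suc n + j))"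
    using Suc.prems(1) by (intro eq_matI) (auto simp: mat_delete_def)
  finally show ?case .
qed

text \<open>An increasing choice of \<open>k\<close> among \<open>k + 1\<close> rows omits exactly
  one row \<open>s\<close>, and \<open>insert_index s\<close> enumerates the others. This turns
  minors with one row fewer into cofactors.\<close>

lemma strict_mono_on_eq_insert_index:
  fixes r :: "nat \<Rightarrow> nat"
  assumes mono: "strict_mono_on {..<k} r" and range: "r ` {..<k} \<subseteq> {..<Suc k}"
  obtains s where "s < Suc k" "\<And>i. i < k \<Longrightarrow> r i = insert_index s i"
proof -
  have grow: "r i + d \<le> r (i + d)" if "i + d < k" for i d
    using that
  proof (induction d)
    case (Suc d)
    then have "r (i + d) < r (i + Suc d)"
      using mono by (auto simp: strict_mono_on_def)
    with Suc show ?case by simp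
  qed simp
  have lower: "i \<le> r i" if "i < k" for i
    using grow[of 0 i] that by simp
  have upper: "r i \<le> Suc i" if "i < k" for i
  proof -
    have "r (k - 1) \<in> r ` {..<k}" using that by simp
    with range have "r (k - 1) < Suc k" by blast
    with grow[of i "k - 1 - i"] that show ?thesis by simp
  qed
  \<comment> \<open>The first index at which \<open>r\<close> has skipped a value; the default
    \<open>k\<close> covers the case that only the last row is omitted.\<close>
  define s where "s = (LEAST i. i = k \<or> r i = Suc i)"
  have s: "s = k \<or> r s = Suc s" and s_le: "s \<le> k"
    unfolding s_def by (rule LeastI[of _ k], simp, rule Least_le, simp)
  show thesis
  proof (rule that)
    show "s < Suc k" using s_le by simp
    fix i assume i: "i < k"
    show "r i = insert_index s i"
    proof (cases "i < s")
      case True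
      then have "r i \<noteq> Suc i" unfolding s_def using not_less_Least by blast
      with True lower[OF i] upper[OF i] show ?thesis by simp
    next
      case False
      then have "r s + (i - s) \<le> r i" using grow[of s "i - s"] i by simp
      with False s i upper[OF i] show ?thesis by simp
    qed
  qed
qed

lemma mat_delete_insert_index:
  "mat_delete A i j = mat (dim_row A - 1) (dim_col A - 1)
     (\<lambda>(i', j'). A $$ (insert_index i i', insert_index j j'))"
  by (simp add: mat_delete_def insert_index_def)

text \<open>A minor is linear in each column, so columns from \<open>\<Phi>\<close> can be replaced
  one at a time by elements of the span without leaving the ideal. The induction is on the number
  \<open>l\<close> of leading columns already replaced.\<close>

lemma minor_in_minor_ideal:
  fixes d :: "nat \<Rightarrow> (nat \<Rightarrow>\<^sub>0 'a::comm_ring_1)"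
  assumes r: "strict_mono_on {..<k} r" "r ` {..<k} \<subseteq> {..<g}"
    and d: "\<And>j. j < k \<Longrightarrow> d j \<in> free_mod.span \<Phi>"
  shows "det (mat k k (\<lambda>(i, j). Poly_Mapping.lookup (d j) (r i))) \<in> minor_ideal k g \<Phi>"
proof -
  define D where "D d = det (mat k k (\<lambda>(i, j). Poly_Mapping.lookup (d j) (r i)))"
    for d :: "nat \<Rightarrow> (nat \<Rightarrow>\<^sub>0 'a)"
  have "D d \<in> minor_ideal k g \<Phi>"
    if "l \<le> k" "\<And>j. j < l \<Longrightarrow> d j \<in> free_mod.span \<Phi>" "\<And>j. l \<le> j \<Longrightarrow> j < k \<Longrightarrow> d j \<in> \<Phi>"
    for l and d :: "nat \<Rightarrow> (nat \<Rightarrow>\<^sub>0 'a)"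
    using that
  proof (induction l arbitrary: d)
    case 0
    show ?case
    proof (cases "inj_on d {..<k}")
      case True
      then show ?thesis
        using r 0 unfolding minor_ideal_def D_def by (intro ring_mod.span_base) blast
    next
      case False
      \<comment> \<open>A repeated column is excluded by the definition of
        \<open>minor_ideal\<close>, but the determinant is then zero.\<close>
      then obtain i j where ij: "i < k" "j < k" "i \<noteq> j" "d i = d j"
        by (auto simp: inj_on_def)
      have "D d = 0"
        unfolding D_def by (rule det_identical_columns[of _ k i j]) (use ij in \<open>auto simp: col_def\<close>)
      then show ?thesis by (simp add: minor_ideal_def ring_mod.span_zero)
    qed
  next
    case (Suc l)
    have l: "l < k" using Suc.prems by simp
    define c where "c i = cofactor (mat k k (\<lambda>(i, j). Poly_Mapping.lookup (d j) (r i))) i l" for i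
    \<comment> \<open>Expansion along column \<open>l\<close> exhibits the linearity: the cofactors
      \<open>c i\<close> do not involve that column.\<close>
    have D: "D (d(l := v)) = (\<Sum>i<k. Poly_Mapping.lookup v (r i) * c i)" for v
    proof -
      let ?A = "mat k k (\<lambda>(i, j). Poly_Mapping.lookup ((d(l := v)) j) (r i))"
      have "D (d(l := v)) = (\<Sum>i<k. ?A $$ (i, l) * cofactor ?A i l)"
        unfolding D_def by (rule laplace_expansion_column[OF _ l]) simp
      also have "\<dots> = (\<Sum>i<k. Poly_Mapping.lookup v (r i) * c i)"
      proof (rule sum.cong[OF refl])
        fix i assume "i \<in> {..<k}"
        then have i: "i < k" by simp
        have "mat_delete ?A i l = mat_delete (mat k k (\<lambda>(i, j). Poly_Mapping.lookup (d j) (r i))) i l"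
          using l i by (intro eq_matI) (auto simp: mat_delete_def)
        then show "?A $$ (i, l) * cofactor ?A i l = Poly_Mapping.lookup v (r i) * c i"
          using l i by (simp add: c_def cofactor_def)
      qed
      finally show ?thesis .
    qed
    have "free_mod.span \<Phi> \<subseteq> {v. D (d(l := v)) \<in> minor_ideal k g \<Phi>}"
    proof (rule free_mod.span_minimal)
      show "\<Phi> \<subseteq> {v. D (d(l := v)) \<in> minor_ideal k g \<Phi>}"
        using Suc.prems by (auto intro!: Suc.IH)
      show "free_mod.subspace {v. D (d(l := v)) \<in> minor_ideal k g \<Phi>}"
        unfolding D
      proof (rule free_mod.subspaceI; simp add: minor_ideal_def)
        show "0 \<in> ring_mod.span S" for S :: "'a set" by (rule ring_mod.span_zero)
      next
        fix x y :: "nat \<Rightarrow>\<^sub>0 'a" and S :: "'a set"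
        assume "(\<Sum>i<k. Poly_Mapping.lookup x (r i) * c i) \<in> ring_mod.span S"
          "(\<Sum>i<k. Poly_Mapping.lookup y (r i) * c i) \<in> ring_mod.span S"
        from ring_mod.span_add[OF this]
        show "(\<Sum>i<k. Poly_Mapping.lookup (x + y) (r i) * c i) \<in> ring_mod.span S"
          by (simp add: lookup_add distrib_right sum.distrib)
      next
        fix a and x :: "nat \<Rightarrow>\<^sub>0 'a" and S :: "'a set"
        assume "(\<Sum>i<k. Poly_Mapping.lookup x (r i) * c i) \<in> ring_mod.span S"
        from ring_mod.span_scale[OF this, of a]
        show "(\<Sum>i<k. a * Poly_Mapping.lookup x (r i) * c i) \<in> ring_mod.span S"
          by (simp add: sum_distrib_left mult.assoc)
      qed
    qed
    then have "D (d(l := d l)) \<in> minor_ideal k g \<Phi>"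
      using Suc.prems(2)[of l] by blast
    then show ?case by simp
  qed
  from this[of k d] d show ?thesis by (simp add: D_def)
qed

section \<open>Row vectors and the determinants attached to a generating tuple\<close>

context comm_module
begin

lemma row_mult_dim [simp]: "dim_vec (row_mult m A) = dim_col A"
  and row_mult_index: "j < dim_col A \<Longrightarrow> row_mult m A $ j = (\<Sum>i<dim_row A. scale (A $$ (i, j)) (m $ i))"
  by (simp_all add: row_mult_def)

lemma row_mult_mult:
  assumes "dim_col A = dim_row B"
  shows "row_mult m (A * B) = row_mult (row_mult m A) B"
proof (rule eq_vecI)
  fix j assume "j < dim_vec (row_mult (row_mult m A) B)"
  then have j: "j < dim_col B" by simp
  have "row_mult m (A * B) $ j =
      (\<Sum>i<dim_row A. \<Sum>l<dim_row B. scale (B $$ (l, j)) (scale (A $$ (i, l)) (m $ i)))"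
    using j assms by (simp add: row_mult_index scalar_prod_def scale_sum_left atLeast0LessThan mult.commute)
  also have "\<dots> = row_mult (row_mult m A) B $ j"
    using j assms by (subst sum.swap) (simp add: row_mult_index scale_sum_right)
  finally show "row_mult m (A * B) $ j = row_mult (row_mult m A) B $ j" .
qed simp

lemma row_mult_one: "row_mult m (1\<^sub>m (dim_vec m)) = m"
proof (rule eq_vecI)
  fix j assume "j < dim_vec m"
  then have "row_mult m (1\<^sub>m (dim_vec m)) $ j = (\<Sum>i<dim_vec m. if i = j then m $ j else 0)"
    using \<open>j < dim_vec m\<close> by (subst row_mult_index, simp) (rule sum.cong, auto)
  then show "row_mult m (1\<^sub>m (dim_vec m)) $ j = m $ j"
    using \<open>j < dim_vec m\<close> by simp
qed simp

lemma span_vec_set: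
  "span (set\<^sub>v m) = range (\<lambda>c. \<Sum>i<dim_vec m. scale (c i) (m $ i))" (is "_ = ?R")
proof
  show "span (set\<^sub>v m) \<subseteq> ?R"
  proof (rule span_minimal)
    show "set\<^sub>v m \<subseteq> ?R"
    proof
      fix x assume "x \<in> set\<^sub>v m"
      then obtain i where i: "x = m $ i" "i < dim_vec m" by (auto elim: vec_setE)
      have "(\<Sum>l<dim_vec m. scale (if l = i then 1 else 0) (m $ l)) =
          (\<Sum>l<dim_vec m. if l = i then m $ i else 0)"
        by (rule sum.cong) auto
      also have "\<dots> = x" using i by simp
      finally show "x \<in> ?R"
        by (intro image_eqI[of _ _ "\<lambda>l. if l = i then 1 else 0"]) simp_all
    qed
    show "subspace ?R"
    proof (rule subspaceI)
      show "0 \<in> ?R" by (rule image_eqI[of _ _ "\<lambda>_. 0"]) simp_all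
    next
      fix x y assume "x \<in> ?R" "y \<in> ?R"
      then obtain c d where "x = (\<Sum>i<dim_vec m. scale (c i) (m $ i))"
        "y = (\<Sum>i<dim_vec m. scale (d i) (m $ i))" by blast
      then show "x + y \<in> ?R"
        by (intro image_eqI[of _ _ "\<lambda>i. c i + d i"]) (simp_all add: scale_left_distrib sum.distrib)
    next
      fix a x assume "x \<in> ?R"
      then obtain c where "x = (\<Sum>i<dim_vec m. scale (c i) (m $ i))" by blast
      then show "scale a x \<in> ?R"
        by (intro image_eqI[of _ _ "\<lambda>i. a * c i"]) (simp_all add: scale_sum_right)
    qed
  qed
  show "?R \<subseteq> span (set\<^sub>v m)"
    by (intro image_subsetI span_sum span_scale span_base) (simp add: vec_set_def)
qed

definition at_most_one_nonzero :: "'b vec \<Rightarrow> bool"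
  where "at_most_one_nonzero v \<longleftrightarrow> (\<forall>i<dim_vec v. \<forall>j<dim_vec v. v $ i \<noteq> 0 \<longrightarrow> v $ j \<noteq> 0 \<longrightarrow> i = j)"

lemma at_most_one_nonzero_vec: "at_most_one_nonzero (vec n f) \<longleftrightarrow> (\<forall>i<n. \<forall>j<n. f i \<noteq> 0 \<longrightarrow> f j \<noteq> 0 \<longrightarrow> i = j)"
  by (simp add: at_most_one_nonzero_def)

text \<open>All columns of such an \<open>A\<close>, with at most one exception, are relations of
  \<open>m\<close>. Expansion along the exceptional column links these determinants to the minors of
  size one less.\<close>

definition rel_dets :: "'b vec \<Rightarrow> 'a set"
  where "rel_dets m = ring_mod.span
    {det A | A. A \<in> carrier_mat (dim_vec m) (dim_vec m) \<and> at_most_one_nonzero (row_mult m A)}"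

text \<open>Only the first \<open>dim_vec m\<close> rows are paired with \<open>m\<close>; the
  \<open>n\<close> extra rows are arbitrary. Expansion along the last row removes an extra row and
  some column, and removing a column cannot create a second nonzero entry.\<close>

lemma det_in_rel_dets:
  assumes "B \<in> carrier_mat (dim_vec m + n) (dim_vec m + n)"
    and "at_most_one_nonzero (vec (dim_vec m + n) (\<lambda>j. \<Sum>i<dim_vec m. scale (B $$ (i, j)) (m $ i)))"
  shows "det B \<in> rel_dets m"
  using assms
proof (induction n arbitrary: B)
  case 0
  moreover have "vec (dim_vec m) (\<lambda>j. \<Sum>i<dim_vec m. scale (B $$ (i, j)) (m $ i)) = row_mult m B"
    using 0 by (intro eq_vecI) (auto simp: row_mult_index)
  ultimately show ?case
    unfolding rel_dets_def by (intro ring_mod.span_base) auto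
next
  case (Suc n)
  let ?g = "dim_vec m + n"
  have B: "B \<in> carrier_mat (Suc ?g) (Suc ?g)" using Suc.prems(1) by simp
  have "det (mat_delete B ?g l) \<in> rel_dets m" if l: "l < Suc ?g" for l
  proof (rule Suc.IH)
    show "mat_delete B ?g l \<in> carrier_mat ?g ?g"
      using mat_delete_carrier[OF B] by simp
    have eq: "(\<Sum>i<dim_vec m. scale (mat_delete B ?g l $$ (i, j)) (m $ i)) =
        (\<Sum>i<dim_vec m. scale (B $$ (i, insert_index l j)) (m $ i))" if "j < ?g" for j
      using B that by (intro sum.cong) (auto simp: mat_delete_insert_index)
    have bound: "insert_index l j < Suc ?g" if "j < ?g" for j
      using that by (simp add: insert_index_def)
    show "at_most_one_nonzero (vec ?g (\<lambda>j. \<Sum>i<dim_vec m. scale (mat_delete B ?g l $$ (i, j)) (m $ i)))"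
      unfolding at_most_one_nonzero_vec
    proof (intro allI impI)
      fix i j
      assume ij: "i < ?g" "j < ?g"
        and "(\<Sum>l'<dim_vec m. scale (mat_delete B ?g l $$ (l', i)) (m $ l')) \<noteq> 0"
        and "(\<Sum>l'<dim_vec m. scale (mat_delete B ?g l $$ (l', j)) (m $ l')) \<noteq> 0"
      then have "insert_index l i = insert_index l j"
        using Suc.prems(2) bound[OF ij(1)] bound[OF ij(2)] unfolding eq[OF ij(1)] eq[OF ij(2)]
        by (auto simp: at_most_one_nonzero_vec)
      then show "i = j" using insert_index_inj_on[of l UNIV] by (auto dest: injD)
    qed
  qed
  then have "(\<Sum>j<Suc ?g. B $$ (?g, j) * cofactor B ?g j) \<in> rel_dets m"
    unfolding rel_dets_def cofactor_def mult.assoc[symmetric]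
    by (intro ring_mod.span_sum ring_mod.span_scale) simp
  then show ?case using laplace_expansion_row[OF B, of ?g] by simp
qed

text \<open>If \<open>m' = m C\<close> and \<open>m = m' D\<close>, the block matrix with rows \<open>(1 - C D, C A)\<close> and \<open>(-D, A)\<close>
  has the same determinant as \<open>A\<close>, and its upper rows send \<open>m\<close> to \<open>(0, m' A)\<close>.\<close>

lemma rel_dets_mono:
  assumes "m' \<in> V g' M" "m \<in> V g M"
  shows "rel_dets m' \<subseteq> rel_dets m"
  unfolding rel_dets_def[of m']
proof (rule ring_mod.span_minimal; clarify?)
  show "ring_mod.subspace (rel_dets m)" by (simp add: rel_dets_def)
  have dims: "dim_vec m = g" "dim_vec m' = g'" and spans: "span (set\<^sub>v m) = M" "span (set\<^sub>v m') = M"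
    using assms by (auto simp: V_def)
  \<comment> \<open>Coordinates of one generating tuple in terms of the other; used in both
    directions, they give \<open>C\<close> and \<open>D\<close>.\<close>
  have comb: "\<exists>c. \<forall>j<dim_vec n'. n' $ j = (\<Sum>i<dim_vec n. scale (c i j) (n $ i))"
    if "span (set\<^sub>v n) = M" "span (set\<^sub>v n') = M" for n n'
  proof -
    have "\<forall>j\<in>{..<dim_vec n'}. \<exists>c. n' $ j = (\<Sum>i<dim_vec n. scale (c i) (n $ i))"
    proof
      fix j assume "j \<in> {..<dim_vec n'}"
      then have "n' $ j \<in> span (set\<^sub>v n')" by (intro span_base) (simp add: vec_set_def)
      then show "\<exists>c. n' $ j = (\<Sum>i<dim_vec n. scale (c i) (n $ i))"
        using that by (auto simp: span_vec_set)
    qed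
    from bchoice[OF this] obtain c where "\<forall>j\<in>{..<dim_vec n'}. n' $ j = (\<Sum>i<dim_vec n. scale (c j i) (n $ i))" ..
    then show ?thesis by (intro exI[of _ "\<lambda>i j. c j i"]) auto
  qed
  obtain c where c: "\<And>j. j < g' \<Longrightarrow> m' $ j = (\<Sum>i<g. scale (c i j) (m $ i))"
    using comb[of m m'] dims spans by auto
  obtain d where d: "\<And>j. j < g \<Longrightarrow> m $ j = (\<Sum>i<g'. scale (d i j) (m' $ i))"
    using comb[of m' m] dims spans by auto
  define C where "C = mat g g' (\<lambda>(i, j). c i j)"
  define D where "D = mat g' g (\<lambda>(i, j). d i j)"
  have C: "C \<in> carrier_mat g g'" "row_mult m C = m'"
    using c dims by (auto simp: C_def row_mult_index intro!: eq_vecI)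
  have D: "D \<in> carrier_mat g' g" "row_mult m' D = m"
    using d dims by (auto simp: D_def row_mult_index intro!: eq_vecI)
  fix A assume A: "A \<in> carrier_mat (dim_vec m') (dim_vec m')" and sp: "at_most_one_nonzero (row_mult m' A)"
  \<comment> \<open>\<open>L\<close> is block triangular with determinant \<open>det A\<close>, and
    the unipotent \<open>U\<close> adds \<open>C\<close> times the lower rows of \<open>L\<close> to
    its upper rows.\<close>
  define L where "L = four_block_mat (1\<^sub>m g) (0\<^sub>m g g') (- D) A"
  define U where "U = four_block_mat (1\<^sub>m g) C (0\<^sub>m g' g) (1\<^sub>m g')"
  note [simp] = dims
  have L: "L \<in> carrier_mat (g + g') (g + g')" and U: "U \<in> carrier_mat (g + g') (g + g')"
    using A by (simp_all add: L_def U_def)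
  have "det L = det (mat g' g' (\<lambda>(i, j). L $$ (g + i, g + j)))"
    by (rule det_identity_rows[OF L]) (use A D in \<open>auto simp: L_def\<close>)
  also have "mat g' g' (\<lambda>(i, j). L $$ (g + i, g + j)) = A"
    using A D by (intro eq_matI) (auto simp: L_def)
  finally have detL: "det L = det A" .
  have "det U = prod_list (diag_mat U)"
    by (rule det_upper_triangular[OF _ U]) (auto simp: U_def C_def upper_triangular_def)
  also have "diag_mat U = map (\<lambda>_. 1) [0..<g + g']"
    by (auto simp: diag_mat_def U_def C_def intro!: map_cong)
  also have "prod_list \<dots> = 1" by (simp add: map_replicate_const)
  finally have detU: "det U = 1" .
  have UL: "U * L = four_block_mat (1\<^sub>m g * 1\<^sub>m g + C * - D) (1\<^sub>m g * 0\<^sub>m g g' + C * A)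
      (0\<^sub>m g' g * 1\<^sub>m g + 1\<^sub>m g' * - D) (0\<^sub>m g' g * 0\<^sub>m g g' + 1\<^sub>m g' * A)"
    unfolding U_def L_def by (rule mult_four_block_mat) (use A C D in auto)
  \<comment> \<open>On the first \<open>g\<close> columns the upper rows give
    \<open>m - m C D = m - m' D = 0\<close>.\<close>
  have left: "(\<Sum>i<g. scale ((U * L) $$ (i, j)) (m $ i)) = 0" if "j < g" for j
  proof -
    have "(\<Sum>i<g. scale ((U * L) $$ (i, j)) (m $ i)) =
        (\<Sum>i<g. scale (1\<^sub>m g $$ (i, j)) (m $ i) - scale ((C * D) $$ (i, j)) (m $ i))"
      unfolding UL using A C D that
      by (intro sum.cong) (auto simp: scale_left_diff_distrib[symmetric])
    also have "\<dots> = row_mult m (1\<^sub>m (dim_vec m)) $ j - row_mult m (C * D) $ j"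
      using C D that by (simp add: sum_subtractf row_mult_index)
    also have "\<dots> = 0"
      using C D by (simp add: row_mult_mult row_mult_one del: dims)
    finally show ?thesis .
  qed
  have right: "(\<Sum>i<g. scale ((U * L) $$ (i, g + j)) (m $ i)) = row_mult m' A $ j" if "j < g'" for j
  proof -
    have "(\<Sum>i<g. scale ((U * L) $$ (i, g + j)) (m $ i)) = row_mult m (C * A) $ j"
      unfolding UL using A C D that by (auto simp: row_mult_index intro!: sum.cong)
    also have "\<dots> = row_mult m' A $ j"
      using A C by (simp add: row_mult_mult)
    finally show ?thesis .
  qed
  have support: "\<exists>l<g'. i = g + l \<and> row_mult m' A $ l \<noteq> 0"
    if "i < g + g'" "(\<Sum>l<g. scale ((U * L) $$ (l, i)) (m $ l)) \<noteq> 0" for i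
  proof -
    have "g \<le> i" using left[of i] that by (cases "g \<le> i") auto
    then obtain l where "i = g + l" by (auto simp: le_iff_add)
    with right[of l] that show ?thesis by auto
  qed
  have "det (U * L) \<in> rel_dets m"
  proof (rule det_in_rel_dets)
    show "U * L \<in> carrier_mat (dim_vec m + g') (dim_vec m + g')" using U L by simp
    show "at_most_one_nonzero (vec (dim_vec m + g') (\<lambda>j. \<Sum>i<dim_vec m. scale ((U * L) $$ (i, j)) (m $ i)))"
      unfolding at_most_one_nonzero_vec
    proof (intro allI impI)
      fix i j
      assume "i < dim_vec m + g'" "j < dim_vec m + g'"
        and "(\<Sum>l<dim_vec m. scale ((U * L) $$ (l, i)) (m $ l)) \<noteq> 0"
        and "(\<Sum>l<dim_vec m. scale ((U * L) $$ (l, j)) (m $ l)) \<noteq> 0"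
      then obtain i' j' where "i' < g'" "i = g + i'" "row_mult m' A $ i' \<noteq> 0"
        "j' < g'" "j = g + j'" "row_mult m' A $ j' \<noteq> 0"
        using support[of i] support[of j] by auto
      with sp A show "i = j" by (auto simp: at_most_one_nonzero_def)
    qed
  qed
  then show "det A \<in> rel_dets m"
    using det_mult[OF U L] detU detL by simp
qed

section \<open>Relations and the minors of a presentation\<close>

lemma subspace_relations: "free_mod.subspace (relations m)"
proof (rule free_mod.subspaceI)
  show "0 \<in> relations m" by (simp add: relations_def)
next
  fix x y assume "x \<in> relations m" "y \<in> relations m"
  then show "x + y \<in> relations m"
    using keys_add[of x y] by (auto simp: relations_def lookup_add scale_left_distrib sum.distrib)
next
  fix a x assume x: "x \<in> relations m"
  have "Poly_Mapping.keys (free_scale a x) \<subseteq> Poly_Mapping.keys x"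
    by (auto simp: in_keys_iff)
  with x show "free_scale a x \<in> relations m"
    by (auto simp: relations_def simp flip: scale_scale scale_sum_right)
qed

text \<open>Appending the unit column at the omitted row \<open>s\<close> to the chosen relations
  gives a square matrix whose determinant is the minor up to sign. Only the last entry of its
  product with \<open>m\<close> can be nonzero.\<close>

lemma minor_ideal_subset_rel_dets:
  assumes "\<Phi> \<subseteq> relations m"
  shows "minor_ideal (dim_vec m - 1) (dim_vec m) \<Phi> \<subseteq> rel_dets m"
proof (cases "dim_vec m")
  case 0
  \<comment> \<open>For the empty tuple, the empty matrix has determinant \<open>1\<close>, so
    \<open>rel_dets m\<close> is the whole ring.\<close>
  have "1 \<in> rel_dets m"
    unfolding rel_dets_def using 0
    by (intro ring_mod.span_base CollectI exI[of _ "1\<^sub>m 0"]) (simp add: at_most_one_nonzero_def)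
  then have "x \<in> rel_dets m" for x
    unfolding rel_dets_def using ring_mod.span_scale[of 1 _ x] by simp
  then show ?thesis by blast
next
  case (Suc k)
  have "det (mat k k (\<lambda>(i, j). Poly_Mapping.lookup (c j) (r i))) \<in> rel_dets m"
    if r: "strict_mono_on {..<k} r" "r ` {..<k} \<subseteq> {..<Suc k}" and c: "c ` {..<k} \<subseteq> \<Phi>" for r c
  proof -
    obtain s where s: "s < Suc k" and rs: "\<And>i. i < k \<Longrightarrow> r i = insert_index s i"
      using strict_mono_on_eq_insert_index[OF r] by blast
    define A where "A = mat (Suc k) (Suc k)
      (\<lambda>(i, j). if j < k then Poly_Mapping.lookup (c j) i else if i = s then 1 else 0)"
    have A: "A \<in> carrier_mat (Suc k) (Suc k)" by (simp add: A_def)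
    have "det A = (\<Sum>i<Suc k. A $$ (i, k) * cofactor A i k)"
      by (rule laplace_expansion_column[OF A]) simp
    also have "\<dots> = (\<Sum>i<Suc k. if i = s then cofactor A s k else 0)"
      by (rule sum.cong) (auto simp: A_def)
    also have "\<dots> = cofactor A s k" using s by simp
    also have "mat_delete A s k = mat k k (\<lambda>(i, j). Poly_Mapping.lookup (c j) (r i))"
      using s by (intro eq_matI) (auto simp: mat_delete_insert_index A_def rs insert_index_def)
    then have "cofactor A s k = (- 1) ^ (s + k) * det (mat k k (\<lambda>(i, j). Poly_Mapping.lookup (c j) (r i)))"
      by (simp add: cofactor_def)
    finally have minor: "det (mat k k (\<lambda>(i, j). Poly_Mapping.lookup (c j) (r i))) = (- 1) ^ (s + k) * det A"
      by (simp add: mult.assoc[symmetric] power_add[symmetric] flip: mult_2)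
    have zero: "row_mult m A $ j = 0" if "j < k" for j
    proof -
      have "c j \<in> relations m" using assms c that by auto
      then show ?thesis
        using that Suc by (simp add: relations_def row_mult_index A_def del: sum.lessThan_Suc)
    qed
    have "at_most_one_nonzero (row_mult m A)"
      unfolding at_most_one_nonzero_def
    proof (intro allI impI)
      fix i j assume "i < dim_vec (row_mult m A)" "j < dim_vec (row_mult m A)"
        "row_mult m A $ i \<noteq> 0" "row_mult m A $ j \<noteq> 0"
      then have "i = k" "j = k"
        using zero[of i] zero[of j] A by (auto simp: less_Suc_eq)
      then show "i = j" by simp
    qed
    then show ?thesis
      unfolding minor rel_dets_def using Suc A by (intro ring_mod.span_scale ring_mod.span_base) auto
  qed
  then show ?thesis
    using Suc unfolding minor_ideal_def
    by (intro ring_mod.span_minimal) (auto simp: rel_dets_def)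
qed

text \<open>Expansion along the one column that may fail to be a relation leaves minors formed from
  relations. As the relations lie in the span of \<open>\<Phi>\<close>,
  \<open>minor_in_minor_ideal\<close> applies.\<close>

lemma rel_dets_subset_minor_ideal:
  assumes "relations m \<subseteq> free_mod.span \<Phi>"
  shows "rel_dets m \<subseteq> minor_ideal (dim_vec m - 1) (dim_vec m) \<Phi>"
  unfolding rel_dets_def
proof (rule ring_mod.span_minimal; clarify?)
  show "ring_mod.subspace (minor_ideal (dim_vec m - 1) (dim_vec m) \<Phi>)"
    by (simp add: minor_ideal_def)
  fix A assume A: "A \<in> carrier_mat (dim_vec m) (dim_vec m)" and sp: "at_most_one_nonzero (row_mult m A)"
  show "det A \<in> minor_ideal (dim_vec m - 1) (dim_vec m) \<Phi>"
  proof (cases "dim_vec m")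
    case 0
    \<comment> \<open>The truncated difference \<open>0 - 1\<close> is \<open>0\<close>, and the
      empty determinant is itself a minor of size \<open>0\<close>.\<close>
    have "det (mat 0 0 (\<lambda>(i, j). Poly_Mapping.lookup (d j) (r i))) \<in> minor_ideal 0 0 \<Phi>"
      for d and r :: "nat \<Rightarrow> nat"
      by (rule minor_in_minor_ideal) (simp_all add: strict_mono_on_def)
    then show ?thesis using A 0 by simp
  next
    case (Suc k)
    \<comment> \<open>If the product of \<open>m\<close> with \<open>A\<close> is zero, any column
      can serve as the exceptional column \<open>l\<close>.\<close>
    have "\<exists>l<Suc k. \<forall>j<Suc k. j \<noteq> l \<longrightarrow> row_mult m A $ j = 0"
      using sp A Suc unfolding at_most_one_nonzero_def by (cases "\<exists>l<Suc k. row_mult m A $ l \<noteq> 0") auto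
    then obtain l where l: "l < Suc k" and zero: "\<And>j. j < Suc k \<Longrightarrow> j \<noteq> l \<Longrightarrow> row_mult m A $ j = 0"
      by blast
    \<comment> \<open>The columns of \<open>A\<close> other than column \<open>l\<close>, regarded
      as elements of the free module.\<close>
    define d where "d j = (\<Sum>i<Suc k. Poly_Mapping.single i (A $$ (i, insert_index l j)))" for j
    have d: "Poly_Mapping.lookup (d j) i = (if i < Suc k then A $$ (i, insert_index l j) else 0)" for i j
    proof -
      have "Poly_Mapping.lookup (d j) i = (\<Sum>i'<Suc k. if i' = i then A $$ (i, insert_index l j) else 0)"
        unfolding d_def lookup_sum lookup_single when_def by (rule sum.cong) auto
      then show ?thesis by (simp only: sum.delta finite_lessThan lessThan_iff)
    qed
    have rel: "d j \<in> relations m" if "j < k" for j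
    proof -
      have "insert_index l j < Suc k" using that by (simp add: insert_index_def)
      from zero[OF this]
      have "(\<Sum>i<Suc k. scale (A $$ (i, insert_index l j)) (m $ i)) = 0"
        using A Suc \<open>insert_index l j < Suc k\<close> by (simp add: row_mult_index del: sum.lessThan_Suc)
      then have "(\<Sum>i<Suc k. scale (Poly_Mapping.lookup (d j) i) (m $ i)) = 0"
        by (simp add: d del: sum.lessThan_Suc)
      moreover have "Poly_Mapping.keys (d j) \<subseteq> {..<Suc k}"
        by (auto simp: in_keys_iff d split: if_splits)
      ultimately show ?thesis by (simp add: relations_def Suc)
    qed
    have "det (mat_delete A i l) \<in> minor_ideal k (Suc k) \<Phi>" if i: "i < Suc k" for i
    proof -
      have "det (mat k k (\<lambda>(i', j). Poly_Mapping.lookup (d j) (insert_index i i'))) \<in> minor_ideal k (Suc k) \<Phi>"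
        using rel assms by (intro minor_in_minor_ideal) (auto simp: strict_mono_on_def insert_index_def)
      also have "mat k k (\<lambda>(i', j). Poly_Mapping.lookup (d j) (insert_index i i')) = mat_delete A i l"
        using A Suc i by (intro eq_matI) (auto simp: mat_delete_insert_index d insert_index_def)
      finally show ?thesis .
    qed
    then have "(\<Sum>i<Suc k. A $$ (i, l) * cofactor A i l) \<in> minor_ideal k (Suc k) \<Phi>"
      unfolding minor_ideal_def cofactor_def mult.assoc[symmetric]
      by (intro ring_mod.span_sum ring_mod.span_scale) simp
    then show ?thesis using laplace_expansion_column[OF _ l, of A] A Suc by (simp del: sum.lessThan_Suc)
  qed
qed

text \<open>Every presentation on generators \<open>m'\<close> has minor ideal
  \<open>rel_dets m'\<close>, and \<open>rel_dets_mono\<close> used in both directions makes this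
  the same for all generating tuples. Existence comes from the presentation whose columns are all
  relations of \<open>m\<close>.\<close>

lemma fitting_ideal_1:
  assumes "m \<in> V g M"
  shows "fitting_ideal 1 M = minor_ideal (g - 1) g (relations m)"
  unfolding fitting_ideal_def
proof (rule the_equality)
  have "free_mod.span (relations m) = relations m"
    using subspace_relations by simp
  then show "\<exists>g' m' \<Phi>. free_presentation M g' m' \<Phi> \<and>
      minor_ideal (g - 1) g (relations m) = minor_ideal (g' - 1) g' \<Phi>"
    using assms unfolding free_presentation_def by blast
  have minors: "minor_ideal (g' - 1) g' \<Phi> = rel_dets m'" if "free_presentation M g' m' \<Phi>" for g' m' \<Phi>
  proof -
    have "dim_vec m' = g'" "free_mod.span \<Phi> = relations m'"
      using that by (auto simp: free_presentation_def V_def)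
    then show ?thesis
      using minor_ideal_subset_rel_dets[of \<Phi> m'] rel_dets_subset_minor_ideal[of m' \<Phi>]
        free_mod.span_superset[of \<Phi>] by auto
  qed
  fix J assume "\<exists>g' m' \<Phi>. free_presentation M g' m' \<Phi> \<and> J = minor_ideal (g' - 1) g' \<Phi>"
  then obtain g' m' \<Phi> where *: "free_presentation M g' m' \<Phi>" "J = minor_ideal (g' - 1) g' \<Phi>" by blast
  then have "J = rel_dets m'" "m' \<in> V g' M" using minors by (auto simp: free_presentation_def)
  then have "J = rel_dets m" using rel_dets_mono assms by blast
  moreover have "free_presentation M g m (relations m)"
    using assms \<open>free_mod.span (relations m) = relations m\<close> by (simp add: free_presentation_def)
  ultimately show "J = minor_ideal (g - 1) g (relations m)" using minors by simp
qed

end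

lemma det_carrier_2:
  fixes A :: "'a::comm_ring_1 mat"
  assumes "A \<in> carrier_mat 2 2"
  shows "det A = A $$ (0, 0) * A $$ (1, 1) - A $$ (0, 1) * A $$ (1, 0)"
proof -
  have "det A = (\<Sum>i<2. A $$ (i, 0) * cofactor A i 0)"
    by (rule laplace_expansion_column[OF assms]) simp
  moreover have "det (mat_delete A i 0) = A $$ (if i = 0 then 1 else 0, 1)" if "i < 2" for i
    using that assms mat_delete_carrier[OF assms, of i 0]
    by (subst det_single) (auto simp: mat_delete_def)
  ultimately show ?thesis by (simp add: cofactor_def numeral_2_eq_2 mult.commute)
qed

section \<open>The exterior square of a two-generated module\<close>

definition linear_extension :: "('k \<Rightarrow> 'a) \<Rightarrow> ('k \<Rightarrow>\<^sub>0 'a::comm_ring_1) \<Rightarrow> 'a"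
  where "linear_extension h v = (\<Sum>k\<in>Poly_Mapping.keys v. Poly_Mapping.lookup v k * h k)"

text \<open>Allows sums over different supports to be compared over one finite set.\<close>

lemma linear_extension_eq:
  assumes "finite S" "Poly_Mapping.keys v \<subseteq> S"
  shows "linear_extension h v = (\<Sum>k\<in>S. Poly_Mapping.lookup v k * h k)"
  unfolding linear_extension_def using assms
  by (intro sum.mono_neutral_left) (auto simp: in_keys_iff)

lemma linear_extension_add:
  "linear_extension h (v + w) = linear_extension h v + linear_extension h w"
proof -
  let ?S = "Poly_Mapping.keys v \<union> Poly_Mapping.keys w"
  have "linear_extension h u = (\<Sum>k\<in>?S. Poly_Mapping.lookup u k * h k)"
    if "u \<in> {v, w, v + w}" for u
    using that keys_add[of v w] by (intro linear_extension_eq) auto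
  then show ?thesis by (simp add: lookup_add distrib_right sum.distrib)
qed

lemma linear_extension_scale:
  "linear_extension h (free_scale r v) = r * linear_extension h v"
proof -
  have "linear_extension h (free_scale r v) =
      (\<Sum>k\<in>Poly_Mapping.keys v. Poly_Mapping.lookup (free_scale r v) k * h k)"
    by (rule linear_extension_eq) (auto simp: in_keys_iff)
  then show ?thesis by (simp add: linear_extension_def sum_distrib_left mult.assoc)
qed

lemma linear_extension_diff:
  "linear_extension h (v - w) = linear_extension h v - linear_extension h w"
  using linear_extension_add[of h "v - w" w] by simp

lemma linear_extension_single [simp]: "linear_extension h (Poly_Mapping.single k 1) = h k"
  by (simp add: linear_extension_def)

text \<open>Reduces closure arguments about the exterior square to the basis elements
  \<open>pair x y\<close>.\<close>

lemma poly_mapping_in_span_single: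
  fixes p :: "'k \<Rightarrow>\<^sub>0 'a::comm_ring_1"
  assumes "Poly_Mapping.keys p \<subseteq> S"
  shows "p \<in> free_mod.span ((\<lambda>k. Poly_Mapping.single k 1) ` S)"
proof -
  have "p = (\<Sum>k\<in>Poly_Mapping.keys p. free_scale (Poly_Mapping.lookup p k) (Poly_Mapping.single k 1))"
  proof (rule poly_mapping_eqI)
    fix i
    have "Poly_Mapping.lookup (\<Sum>k\<in>Poly_Mapping.keys p.
          free_scale (Poly_Mapping.lookup p k) (Poly_Mapping.single k 1)) i =
        (\<Sum>k\<in>Poly_Mapping.keys p. if k = i then Poly_Mapping.lookup p i else 0)"
      unfolding lookup_sum by (rule sum.cong) (auto simp: lookup_single when_def)
    then show "Poly_Mapping.lookup p i = Poly_Mapping.lookup (\<Sum>k\<in>Poly_Mapping.keys p.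
        free_scale (Poly_Mapping.lookup p k) (Poly_Mapping.single k 1)) i"
      by (simp add: in_keys_iff)
  qed
  moreover have "\<dots> \<in> free_mod.span ((\<lambda>k. Poly_Mapping.single k 1) ` S)"
    using assms by (intro free_mod.span_sum free_mod.span_scale free_mod.span_base) auto
  ultimately show ?thesis by simp
qed

lemma residue_eq_iff:
  assumes "ring_mod.subspace J"
  shows "residue J r = residue J s \<longleftrightarrow> r - s \<in> J"
proof
  assume "residue J r = residue J s"
  moreover have "r \<in> residue J r" using assms by (simp add: residue_def ring_mod.subspace_0)
  ultimately show "r - s \<in> J" by (simp add: residue_def)
next
  assume rs: "r - s \<in> J"
  have "x - r \<in> J \<longleftrightarrow> x - s \<in> J" for x
    using ring_mod.subspace_add[OF assms _ rs, of "x - r"] ring_mod.subspace_diff[OF assms _ rs, of "x - s"]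
    by auto
  then show "residue J r = residue J s" by (simp add: residue_def)
qed

lemma vec_set_dim_2: "dim_vec v = 2 \<Longrightarrow> set\<^sub>v v = {v $ 0, v $ 1}"
  by (auto simp: vec_set_def numeral_2_eq_2 lessThan_Suc)

section \<open>Generating pairs and their first Fitting ideal\<close>

context comm_module
begin

lemma V_2D:
  assumes "m \<in> V 2 M"
  shows "dim_vec m = 2" "M = span {m $ 0, m $ 1}"
proof -
  show dim: "dim_vec m = 2" using assms by (auto simp: V_def)
  then show "M = span {m $ 0, m $ 1}" using assms by (auto simp: V_def vec_set_dim_2)
qed

lemma span_pair_in_V_2: "vec 2 (\<lambda>i. if i = 0 then a else b) \<in> V 2 (span {a, b})"
proof -
  have "set\<^sub>v (vec 2 (\<lambda>i. if i = 0 then a else b)) = {a, b}"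
    by (subst vec_set_dim_2) auto
  then show ?thesis by (simp add: V_def)
qed

lemma in_span_pair: "x \<in> span {a, b} \<longleftrightarrow> (\<exists>p q. x = scale p a + scale q b)"
  by (auto simp: span_insert span_singleton diff_eq_eq add.commute)

definition relation_coefficients :: "'b \<Rightarrow> 'b \<Rightarrow> 'a set"
  where "relation_coefficients a b = ring_mod.span
    {r. \<exists>x y. scale x a + scale y b = 0 \<and> (r = x \<or> r = y)}"

lemma subspace_relation_coefficients: "ring_mod.subspace (relation_coefficients a b)"
  by (simp add: relation_coefficients_def)

lemma relation_coefficientsI:
  assumes "scale x a + scale y b = 0"
  shows "x \<in> relation_coefficients a b" "y \<in> relation_coefficients a b"
  using assms unfolding relation_coefficients_def by (blast intro: ring_mod.span_base)+

text \<open>For two generators the minors of size \<open>2 - 1\<close> are single entries: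
  \<open>r 0\<close> selects which of the two coefficients of a relation is taken.\<close>

lemma fitting_ideal_1_pair:
  assumes "m \<in> V 2 M"
  shows "fitting_ideal 1 M = relation_coefficients (m $ 0) (m $ 1)"
proof -
  have dim: "dim_vec m = 2" using V_2D assms by blast
  have "{det (mat 1 1 (\<lambda>(i, j). Poly_Mapping.lookup (c j) (r i))) | r c.
       strict_mono_on {..<1} r \<and> r ` {..<1} \<subseteq> {..<2} \<and>
       inj_on c {..<1} \<and> c ` {..<1} \<subseteq> relations m} =
    {r. \<exists>x y. scale x (m $ 0) + scale y (m $ 1) = 0 \<and> (r = x \<or> r = y)}" (is "?L = ?R")
  proof
    show "?L \<subseteq> ?R"
    proof clarify
      fix r :: "nat \<Rightarrow> nat" and c :: "nat \<Rightarrow> nat \<Rightarrow>\<^sub>0 'a"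
      assume r: "r ` {..<1} \<subseteq> {..<2}" and c: "c ` {..<1} \<subseteq> relations m"
      have "r 0 = 0 \<or> r 0 = 1" using r by (auto simp: lessThan_Suc)
      moreover have "c 0 \<in> relations m" using c by auto
      moreover have "det (mat 1 1 (\<lambda>(i, j). Poly_Mapping.lookup (c j) (r i))) = Poly_Mapping.lookup (c 0) (r 0)"
        by (subst det_single) auto
      ultimately show "\<exists>x y. scale x (m $ 0) + scale y (m $ 1) = 0 \<and>
          (det (mat 1 1 (\<lambda>(i, j). Poly_Mapping.lookup (c j) (r i))) = x \<or>
           det (mat 1 1 (\<lambda>(i, j). Poly_Mapping.lookup (c j) (r i))) = y)"
        by (intro exI[of _ "Poly_Mapping.lookup (c 0) 0"] exI[of _ "Poly_Mapping.lookup (c 0) 1"])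
          (auto simp: relations_def dim numeral_2_eq_2)
    qed
    show "?R \<subseteq> ?L"
    proof clarify
      fix r x y assume rel: "scale x (m $ 0) + scale y (m $ 1) = 0" and r: "r = x \<or> r = y"
      define v where "v = Poly_Mapping.single 0 x + Poly_Mapping.single (1::nat) y"
      have v: "v \<in> relations m"
        using rel keys_add[of "Poly_Mapping.single 0 x" "Poly_Mapping.single (1::nat) y"]
        by (auto simp: relations_def dim v_def numeral_2_eq_2 lookup_add lookup_single split: if_splits)
      obtain i :: nat where i: "i < 2" "r = Poly_Mapping.lookup v i"
      proof (cases "r = x")
        case True
        then show ?thesis using that[of 0] by (simp add: v_def lookup_add lookup_single)
      next
        case False
        then show ?thesis using that[of 1] r by (simp add: v_def lookup_add lookup_single)
      qed
      \<comment> \<open>The row and column choices are constant maps, which are strictly increasing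
        and injective on a one-element index set.\<close>
      have "r = det (mat 1 1 (\<lambda>(i', j). Poly_Mapping.lookup ((\<lambda>_. v) j) ((\<lambda>_. i) i')))"
        using i by (subst det_single) auto
      then show "\<exists>ra c. r = det (mat 1 1 (\<lambda>(i, j). Poly_Mapping.lookup (c j) (ra i))) \<and>
          strict_mono_on {..<1} ra \<and> ra ` {..<1} \<subseteq> {..<2} \<and> inj_on c {..<1} \<and> c ` {..<1} \<subseteq> relations m"
        by (intro exI[of _ "\<lambda>_. i"] exI[of _ "\<lambda>_. v"] conjI)
          (use i v in \<open>auto simp: strict_mono_on_def inj_on_def\<close>)
    qed
  qed
  moreover have "fitting_ideal 1 M = minor_ideal 1 2 (relations m)"
    using fitting_ideal_1[OF assms] by simp
  ultimately show ?thesis by (simp add: minor_ideal_def relation_coefficients_def)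
qed

section \<open>Calculation in the exterior square\<close>

lemma subspace_ext2_relations: "free_mod.subspace (ext2_relations M)"
  by (simp add: ext2_relations_def)

lemma ext2_class_eq_iff: "ext2_class M p = ext2_class M q \<longleftrightarrow> p - q \<in> ext2_relations M"
proof
  assume "ext2_class M p = ext2_class M q"
  moreover have "p \<in> ext2_class M p"
    by (simp add: ext2_class_def free_mod.subspace_0[OF subspace_ext2_relations])
  ultimately show "p - q \<in> ext2_relations M" by (simp add: ext2_class_def)
next
  assume pq: "p - q \<in> ext2_relations M"
  have "x - p \<in> ext2_relations M \<longleftrightarrow> x - q \<in> ext2_relations M" for x
    using free_mod.subspace_add[OF subspace_ext2_relations _ pq, of "x - p"]
      free_mod.subspace_diff[OF subspace_ext2_relations _ pq, of "x - q"] by auto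
  then show "ext2_class M p = ext2_class M q" by (simp add: ext2_class_def)
qed

lemma ext2_class_add:
  assumes "ext2_class M p = ext2_class M p'" "ext2_class M q = ext2_class M q'"
  shows "ext2_class M (p + q) = ext2_class M (p' + q')"
  using free_mod.subspace_add[OF subspace_ext2_relations, of "p - p'" M "q - q'"] assms
  by (simp add: ext2_class_eq_iff add_diff_add)

lemma ext2_class_scale:
  assumes "ext2_class M p = ext2_class M p'"
  shows "ext2_class M (free_scale r p) = ext2_class M (free_scale r p')"
  using free_mod.subspace_scale[OF subspace_ext2_relations, of "p - p'" M r] assms
  by (simp add: ext2_class_eq_iff free_mod.scale_right_diff_distrib)

text \<open>The union defining \<open>ext2_scale\<close> collapses because all representatives yield
  the same class.\<close>

lemma ext2_scale_class: "ext2_scale M r (ext2_class M p) = ext2_class M (free_scale r p)"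
proof -
  have "p \<in> ext2_class M p"
    by (simp add: ext2_class_def free_mod.subspace_0[OF subspace_ext2_relations])
  moreover have "ext2_class M (free_scale r q) = ext2_class M (free_scale r p)" if "q \<in> ext2_class M p" for q
    using that by (intro ext2_class_scale) (simp add: ext2_class_eq_iff, simp add: ext2_class_def)
  ultimately show ?thesis unfolding ext2_scale_def by blast
qed

lemma ext2_class_pair:
  assumes "x \<in> M" "x' \<in> M" "y \<in> M"
  shows "ext2_class M (pair (x + x') y) = ext2_class M (pair x y + pair x' y)"
    and "ext2_class M (pair y (x + x')) = ext2_class M (pair y x + pair y x')"
    and "ext2_class M (pair (scale r x) y) = ext2_class M (free_scale r (pair x y))"
    and "ext2_class M (pair y (scale r x)) = ext2_class M (free_scale r (pair y x))"
    and "ext2_class M (pair x x) = ext2_class M 0"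
  unfolding ext2_class_eq_iff ext2_relations_def diff_diff_eq[symmetric] diff_zero
  by (rule free_mod.span_base, use assms in blast)+

text \<open>Antisymmetry from expanding \<open>(x + y) \<and> (x + y) = 0\<close>.\<close>

lemma ext2_class_pair_swap:
  assumes "subspace M" "x \<in> M" "y \<in> M"
  shows "ext2_class M (pair y x) = ext2_class M (- pair x y)"
proof -
  \<comment> \<open>The zeros stand for \<open>x \<and> x\<close> and \<open>y \<and> y\<close>, so
    that \<open>ext2_class_add\<close> can compare the sums term by term.\<close>
  have "ext2_class M (0 + (pair x y + (pair y x + 0))) =
      ext2_class M (pair x x + (pair x y + (pair y x + pair y y)))"
    using assms by (intro ext2_class_add refl ext2_class_pair(5)[symmetric])
  also have "\<dots> = ext2_class M ((pair x x + pair x y) + (pair y x + pair y y))"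
    by (simp add: add.assoc)
  also have "\<dots> = ext2_class M (pair x (x + y) + pair y (x + y))"
    using assms by (intro ext2_class_add ext2_class_pair(2)[symmetric])
  also have "\<dots> = ext2_class M (pair (x + y) (x + y))"
    using assms by (intro ext2_class_pair(1)[symmetric] subspace_add)
  also have "\<dots> = ext2_class M 0"
    using assms by (intro ext2_class_pair(5) subspace_add)
  finally show ?thesis by (simp add: ext2_class_eq_iff add.commute)
qed

text \<open>Of the four terms given by bilinearity, those in \<open>a \<and> a\<close> and
  \<open>b \<and> b\<close> vanish, and \<open>b \<and> a\<close> becomes
  \<open>- (a \<and> b)\<close>; what remains is a determinant of size two.\<close>

lemma ext2_class_pair_combination:
  assumes M: "M = span {a, b}"
  shows "ext2_class M (pair (scale p a + scale q b) (scale p' a + scale q' b)) =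
    ext2_class M (free_scale (p * q' - q * p') (pair a b))"
proof -
  have sub: "subspace M" and ab: "a \<in> M" "b \<in> M"
    by (simp_all add: M span_base)
  let ?y = "scale p' a + scale q' b"
  note [intro] = subspace_add subspace_scale sub ab
  have right: "ext2_class M (pair u ?y) =
      ext2_class M (free_scale p' (pair u a) + free_scale q' (pair u b))" if "u \<in> M" for u
  proof -
    have "ext2_class M (pair u ?y) = ext2_class M (pair u (scale p' a) + pair u (scale q' b))"
      using that by (intro ext2_class_pair(2)) auto
    also have "\<dots> = ext2_class M (free_scale p' (pair u a) + free_scale q' (pair u b))"
      \<comment> \<open>\<open>0\<close> instantiates the variable \<open>x'\<close> of
        \<open>ext2_class_pair\<close>, which has to lie in \<open>M\<close>.\<close>
      using that ab by (intro ext2_class_add ext2_class_pair(4)[of _ _ "0::'b"]) (auto intro: subspace_0)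
    finally show ?thesis .
  qed
  have "ext2_class M (pair (scale p a + scale q b) ?y) =
      ext2_class M (pair (scale p a) ?y + pair (scale q b) ?y)"
    by (intro ext2_class_pair(1)) auto
  also have "\<dots> = ext2_class M (free_scale p (pair a ?y) + free_scale q (pair b ?y))"
    by (intro ext2_class_add ext2_class_pair(3)[of _ _ "0::'b"]) (auto intro: subspace_0)
  also have "\<dots> = ext2_class M (free_scale p (free_scale p' (pair a a) + free_scale q' (pair a b)) +
      free_scale q (free_scale p' (pair b a) + free_scale q' (pair b b)))"
    by (intro ext2_class_add ext2_class_scale right ab)
  also have "\<dots> = ext2_class M (free_scale p (free_scale p' 0 + free_scale q' (pair a b)) +
      free_scale q (free_scale p' (- pair a b) + free_scale q' 0))"
    by (intro ext2_class_add ext2_class_scale refl ext2_class_pair(5)[of _ _ "0::'b" "0::'b"] ext2_class_pair_swap)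
      (auto intro: subspace_0)
  also have "free_scale p (free_scale p' 0 + free_scale q' (pair a b)) +
      free_scale q (free_scale p' (- pair a b) + free_scale q' 0) =
      free_scale (p * q' - q * p') (pair a b)"
    by (simp add: free_mod.scale_left_diff_distrib)
  finally show ?thesis .
qed

text \<open>Linear extension of \<open>(x, y) \<mapsto> p\<^sub>x q\<^sub>y - q\<^sub>x p\<^sub>y\<close> for chosen coordinates \<open>x = p\<^sub>x a + q\<^sub>x b\<close>:
  modulo the relation coefficients, the choice does not matter and the map is bilinear and
  alternating.\<close>

lemma annihilator_wedge:
  assumes M: "M = span {a, b}"
  shows "free_scale r (pair a b) \<in> ext2_relations M \<longleftrightarrow> r \<in> relation_coefficients a b"
proof
  let ?J = "relation_coefficients a b"
  have sub: "subspace M" and ab: "a \<in> M" "b \<in> M"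
    by (simp_all add: M span_base)
  note J = subspace_relation_coefficients[of a b]
  have "\<forall>x\<in>M. \<exists>pq. x = scale (fst pq) a + scale (snd pq) b"
    by (auto simp: M in_span_pair)
  then obtain pq where pq: "\<And>x. x \<in> M \<Longrightarrow> x = scale (fst (pq x)) a + scale (snd (pq x)) b"
    by metis
  define P Q where "P x = fst (pq x)" and "Q x = snd (pq x)" for x
  have PQ: "scale (P x) a + scale (Q x) b = x" if "x \<in> M" for x
    using pq[OF that] by (simp add: P_def Q_def)
  \<comment> \<open>Both the coordinates of \<open>x + y\<close> and the sum of the coordinates
    represent \<open>x + y\<close>, so their differences are the coefficients of a relation.\<close>
  have add: "P (x + y) - P x - P y \<in> ?J" "Q (x + y) - Q x - Q y \<in> ?J" if "x \<in> M" "y \<in> M" for x y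
  proof -
    have "scale (P (x + y) - P x - P y) a + scale (Q (x + y) - Q x - Q y) b =
        (scale (P (x + y)) a + scale (Q (x + y)) b) - (scale (P x) a + scale (Q x) b)
          - (scale (P y) a + scale (Q y) b)"
      by (simp add: scale_left_diff_distrib)
    also have "\<dots> = 0" using PQ that subspace_add[OF sub that] by simp
    finally show "P (x + y) - P x - P y \<in> ?J" "Q (x + y) - Q x - Q y \<in> ?J"
      by (rule relation_coefficientsI)+
  qed
  have scl: "P (scale c x) - c * P x \<in> ?J" "Q (scale c x) - c * Q x \<in> ?J" if "x \<in> M" for c x
  proof -
    have "scale (P (scale c x) - c * P x) a + scale (Q (scale c x) - c * Q x) b =
        (scale (P (scale c x)) a + scale (Q (scale c x)) b) - scale c (scale (P x) a + scale (Q x) b)"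
      by (simp add: scale_left_diff_distrib scale_right_distrib)
    also have "\<dots> = 0" using PQ that subspace_scale[OF sub that] by simp
    finally show "P (scale c x) - c * P x \<in> ?J" "Q (scale c x) - c * Q x \<in> ?J"
      by (rule relation_coefficientsI)+
  qed
  define h where "h = (\<lambda>(x, y). P x * Q y - Q x * P y)"
  note JI = ring_mod.subspace_diff[OF J] ring_mod.subspace_scale[OF J]
  have h_add: "h (x + x', y) - h (x, y) - h (x', y) \<in> ?J" "h (y, x + x') - h (y, x) - h (y, x') \<in> ?J"
    if "x \<in> M" "x' \<in> M" for x x' y
  proof -
    \<comment> \<open>The defect of \<open>h\<close> is a linear combination of the defects of
      \<open>P\<close> and \<open>Q\<close>.\<close>
    have "h (x + x', y) - h (x, y) - h (x', y) =
        Q y * (P (x + x') - P x - P x') - P y * (Q (x + x') - Q x - Q x')"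
      by (simp add: h_def algebra_simps)
    then show "h (x + x', y) - h (x, y) - h (x', y) \<in> ?J"
      by (simp only:) (intro JI add that)
    have "h (y, x + x') - h (y, x) - h (y, x') =
        P y * (Q (x + x') - Q x - Q x') - Q y * (P (x + x') - P x - P x')"
      by (simp add: h_def algebra_simps)
    then show "h (y, x + x') - h (y, x) - h (y, x') \<in> ?J"
      by (simp only:) (intro JI add that)
  qed
  have h_scale: "h (scale c x, y) - c * h (x, y) \<in> ?J" "h (y, scale c x) - c * h (y, x) \<in> ?J"
    if "x \<in> M" for c x y
  proof -
    have "h (scale c x, y) - c * h (x, y) =
        Q y * (P (scale c x) - c * P x) - P y * (Q (scale c x) - c * Q x)"
      by (simp add: h_def algebra_simps)
    then show "h (scale c x, y) - c * h (x, y) \<in> ?J"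
      by (simp only:) (intro JI scl that)
    have "h (y, scale c x) - c * h (y, x) =
        P y * (Q (scale c x) - c * Q x) - Q y * (P (scale c x) - c * P x)"
      by (simp add: h_def algebra_simps)
    then show "h (y, scale c x) - c * h (y, x) \<in> ?J"
      by (simp only:) (intro JI scl that)
  qed
  have h_alt: "h (x, x) \<in> ?J" for x
    using ring_mod.subspace_0[OF J] by (simp add: h_def mult.commute)
  have vanish: "ext2_relations M \<subseteq> {v. linear_extension h v \<in> ?J}"
    unfolding ext2_relations_def
  proof (rule free_mod.span_minimal)
    show "free_mod.subspace {v. linear_extension h v \<in> ?J}"
    proof (rule free_mod.subspaceI)
      show "0 \<in> {v. linear_extension h v \<in> ?J}"
        using ring_mod.subspace_0[OF J] by (simp add: linear_extension_def)
    qed (auto simp: linear_extension_add linear_extension_scale intro: ring_mod.subspace_add[OF J]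
        ring_mod.subspace_scale[OF J])
  qed (auto simp: linear_extension_diff linear_extension_scale h_add h_scale h_alt)
  \<comment> \<open>The chosen coordinates of \<open>a\<close> differ from \<open>(1, 0)\<close> by
    a relation, and those of \<open>b\<close> from \<open>(0, 1)\<close>; hence
    \<open>h (a, b)\<close> is \<open>1\<close> modulo \<open>?J\<close>.\<close>
  have "P a - 1 \<in> ?J" "Q a \<in> ?J" "P b \<in> ?J" "Q b - 1 \<in> ?J"
    using PQ[OF ab(1)] PQ[OF ab(2)]
    by (auto intro: relation_coefficientsI[of "P a - 1" _ "Q a"] relation_coefficientsI[of "P b" _ "Q b - 1"]
        simp: scale_left_diff_distrib algebra_simps)
  then have "Q b * (P a - 1) + (Q b - 1) - Q a * P b \<in> ?J"
    using ring_mod.subspace_scale[OF J] by (auto intro!: ring_mod.subspace_diff[OF J] ring_mod.subspace_add[OF J])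
  also have "Q b * (P a - 1) + (Q b - 1) - Q a * P b = h (a, b) - 1"
    by (simp add: h_def algebra_simps)
  finally have h1: "h (a, b) - 1 \<in> ?J" .
  show "r \<in> ?J" if "free_scale r (pair a b) \<in> ext2_relations M"
  proof -
    have "r * h (a, b) \<in> ?J" using vanish that by (auto simp: linear_extension_scale)
    from ring_mod.subspace_diff[OF J this ring_mod.subspace_scale[OF J h1, of r]]
    show ?thesis by (simp add: algebra_simps)
  qed
next
  let ?J = "relation_coefficients a b"
  have "?J \<subseteq> {r. free_scale r (pair a b) \<in> ext2_relations M}"
    unfolding relation_coefficients_def
  proof (rule ring_mod.span_minimal)
    show "ring_mod.subspace {r. free_scale r (pair a b) \<in> ext2_relations M}"
    proof (rule ring_mod.subspaceI)
      show "c * x \<in> {r. free_scale r (pair a b) \<in> ext2_relations M}"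
        if "x \<in> {r. free_scale r (pair a b) \<in> ext2_relations M}" for c x
        using free_mod.subspace_scale[OF subspace_ext2_relations, of "free_scale x (pair a b)" M c] that
        by simp
    qed (auto simp: free_mod.scale_left_distrib free_mod.subspace_0[OF subspace_ext2_relations]
        intro: free_mod.subspace_add[OF subspace_ext2_relations])
    show "{r. \<exists>x y. scale x a + scale y b = 0 \<and> (r = x \<or> r = y)}
        \<subseteq> {r. free_scale r (pair a b) \<in> ext2_relations M}"
    proof clarify
      fix r x y assume rel: "scale x a + scale y b = 0" and r: "r = x \<or> r = y"
      note comb = ext2_class_pair_combination[OF M]
      \<comment> \<open>Here \<open>x (a \<and> b) = (x a + y b) \<and> b = 0\<close>; for
        \<open>y\<close> the element \<open>a \<and> (x a + y b)\<close> is used instead.\<close>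
      have "ext2_class M (free_scale x (pair a b)) = ext2_class M 0"
        using comb[of x y 0 1] comb[of 0 0 0 1] rel by simp
      moreover have "ext2_class M (free_scale y (pair a b)) = ext2_class M 0"
        using comb[of 1 0 x y] comb[of 1 0 0 0] rel by simp
      ultimately show "free_scale r (pair a b) \<in> ext2_relations M"
        using r by (auto simp: ext2_class_eq_iff)
    qed
  qed
  then show "free_scale r (pair a b) \<in> ext2_relations M" if "r \<in> ?J"
    using that by blast
qed

lemma ext2_scale_wedge_eq_iff:
  assumes "M = span {a, b}"
  shows "ext2_scale M r (wedge M a b) = ext2_scale M s (wedge M a b) \<longleftrightarrow> r - s \<in> relation_coefficients a b"
  using annihilator_wedge[OF assms, of "r - s"]
  by (simp add: wedge_def ext2_scale_class ext2_class_eq_iff free_mod.scale_left_diff_distrib)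

lemma wedge_combination:
  assumes "M = span {a, b}"
  shows "wedge M (scale p a + scale q b) (scale p' a + scale q' b) =
    ext2_scale M (p * q' - q * p') (wedge M a b)"
  using ext2_class_pair_combination[OF assms] by (simp add: wedge_def ext2_scale_class)

lemma ext2_scale_scale:
  "ext2_scale M r (ext2_scale M s (wedge M a b)) = ext2_scale M (r * s) (wedge M a b)"
  by (simp add: wedge_def ext2_scale_class)

lemma ext2_scale_one: "ext2_scale M 1 (wedge M a b) = wedge M a b"
  by (simp add: wedge_def ext2_scale_class)

text \<open>The exterior square is cyclic: by the determinant formula each \<open>pair x y\<close>
  is congruent to a multiple of \<open>pair a b\<close>, and the elements with this property form a
  submodule.\<close>

lemma ext2_eq:
  assumes M: "M = span {a, b}"
  shows "ext2 M = range (\<lambda>r. ext2_scale M r (wedge M a b))"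
proof
  have ab: "a \<in> M" "b \<in> M" by (simp_all add: M span_base)
  show "range (\<lambda>r. ext2_scale M r (wedge M a b)) \<subseteq> ext2 M"
  proof clarify
    fix r
    have "Poly_Mapping.keys (free_scale r (pair a b)) \<subseteq> M \<times> M"
      using ab by (auto simp: in_keys_iff lookup_single when_def split: if_splits)
    then show "ext2_scale M r (wedge M a b) \<in> ext2 M"
      by (auto simp: wedge_def ext2_scale_class ext2_def)
  qed
  let ?T = "{p. \<exists>r. ext2_class M p = ext2_class M (free_scale r (pair a b))}"
  have "free_mod.span ((\<lambda>k. Poly_Mapping.single k 1) ` (M \<times> M)) \<subseteq> ?T"
  proof (rule free_mod.span_minimal)
    show "(\<lambda>k. Poly_Mapping.single k 1) ` (M \<times> M) \<subseteq> ?T"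
    proof clarify
      fix x y assume "x \<in> M" "y \<in> M"
      then obtain p q p' q' where "x = scale p a + scale q b" "y = scale p' a + scale q' b"
        using M by (auto simp: in_span_pair)
      then show "\<exists>r. ext2_class M (pair x y) = ext2_class M (free_scale r (pair a b))"
        using ext2_class_pair_combination[OF M, of p q p' q'] by blast
    qed
    show "free_mod.subspace ?T"
    proof (rule free_mod.subspaceI)
      show "0 \<in> ?T" by (auto intro!: exI[of _ 0])
    next
      fix x y assume "x \<in> ?T" "y \<in> ?T"
      then obtain r s where "ext2_class M x = ext2_class M (free_scale r (pair a b))"
        "ext2_class M y = ext2_class M (free_scale s (pair a b))" by blast
      from ext2_class_add[OF this] show "x + y \<in> ?T"
        by (auto simp flip: free_mod.scale_left_distrib)
    next
      fix c x assume "x \<in> ?T"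
      then obtain r where "ext2_class M x = ext2_class M (free_scale r (pair a b))" by blast
      from ext2_class_scale[OF this, of c] show "free_scale c x \<in> ?T" by auto
    qed
  qed
  then show "ext2 M \<subseteq> range (\<lambda>r. ext2_scale M r (wedge M a b))"
    using poly_mapping_in_span_single
    by (fastforce simp: ext2_def wedge_def ext2_scale_class)
qed

text \<open>A multiple of \<open>a \<and> b\<close> generates precisely when
  \<open>a \<and> b\<close> is in turn a multiple of it, which is invertibility of the factor modulo
  the annihilator.\<close>

lemma V1_ext2_eq:
  assumes M: "M = span {a, b}"
  shows "V1_ext2 M = {ext2_scale M r (wedge M a b) | r. \<exists>s. r * s - 1 \<in> relation_coefficients a b}"
proof -
  let ?w = "wedge M a b"
  have mem: "\<omega> \<in> ext2 M \<longleftrightarrow> (\<exists>r. \<omega> = ext2_scale M r ?w)" for \<omega>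
    by (auto simp: ext2_eq[OF M])
  have generates: "{ext2_scale M s (ext2_scale M r ?w) | s. True} = ext2 M \<longleftrightarrow>
      (\<exists>s. r * s - 1 \<in> relation_coefficients a b)" for r
  proof
    assume "{ext2_scale M s (ext2_scale M r ?w) | s. True} = ext2 M"
    moreover have "ext2_scale M 1 ?w \<in> ext2 M" by (simp add: ext2_eq[OF M])
    ultimately have "ext2_scale M 1 ?w \<in> {ext2_scale M s (ext2_scale M r ?w) | s. True}" by simp
    then obtain s where "ext2_scale M (s * r) ?w = ext2_scale M 1 ?w"
      unfolding ext2_scale_scale by auto
    then show "\<exists>s. r * s - 1 \<in> relation_coefficients a b"
      by (auto simp: ext2_scale_wedge_eq_iff[OF M] mult.commute)
  next
    assume "\<exists>s. r * s - 1 \<in> relation_coefficients a b"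
    then obtain s where s: "ext2_scale M (r * s) ?w = ext2_scale M 1 ?w"
      by (auto simp: ext2_scale_wedge_eq_iff[OF M])
    have "ext2_scale M t ?w = ext2_scale M (t * s) (ext2_scale M r ?w)" for t
    proof -
      have "ext2_scale M t ?w = ext2_scale M t (ext2_scale M 1 ?w)" by (simp add: ext2_scale_one)
      also have "\<dots> = ext2_scale M (t * (r * s)) ?w" by (simp add: ext2_scale_scale flip: s)
      finally show ?thesis by (simp add: ext2_scale_scale ac_simps)
    qed
    then show "{ext2_scale M s (ext2_scale M r ?w) | s. True} = ext2 M"
      by (auto simp: ext2_eq[OF M] ext2_scale_scale)
  qed
  define G where "G \<omega> \<longleftrightarrow> {ext2_scale M s \<omega> | s. True} = ext2 M" for \<omega>
  have "V1_ext2 M = {\<omega> \<in> ext2 M. G \<omega>}" by (simp only: V1_ext2_def G_def)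
  moreover have "G (ext2_scale M r ?w) \<longleftrightarrow> (\<exists>s. r * s - 1 \<in> relation_coefficients a b)" for r
    using generates by (simp only: G_def)
  ultimately show ?thesis by (auto simp only: mem)
qed

text \<open>Equality of residues and equality of multiples of \<open>a \<and> b\<close> both mean
  that the difference lies in \<open>J\<close>. So \<open>g\<close>, defined through a chosen
  representative, is well defined and injective; its image is given by
  \<open>V1_ext2_eq\<close>.\<close>

lemma residue_units_bij_V1_ext2:
  assumes M: "M = span {a, b}" and J: "J = relation_coefficients a b"
  shows "\<exists>g. (\<forall>r. residue J r \<in> residue_units J \<longrightarrow> g (residue J r) = ext2_scale M r (wedge M a b)) \<and>
    bij_betw g (residue_units J) (V1_ext2 M)"
proof (intro exI conjI allI impI)
  have subJ: "ring_mod.subspace J" by (simp add: J subspace_relation_coefficients)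
  define g where "g \<rho> = ext2_scale M (SOME r. residue J r = \<rho>) (wedge M a b)" for \<rho>
  have g: "g (residue J r) = ext2_scale M r (wedge M a b)" for r
  proof -
    have "residue J (SOME s. residue J s = residue J r) = residue J r" by (rule someI) simp
    then show ?thesis
      unfolding g_def ext2_scale_wedge_eq_iff[OF M] residue_eq_iff[OF subJ, of _ r] J[symmetric] .
  qed
  show "g (residue J r) = ext2_scale M r (wedge M a b)" for r by (rule g)
  have eq: "g (residue J r) = g (residue J s) \<longleftrightarrow> residue J r = residue J s" for r s
    unfolding g ext2_scale_wedge_eq_iff[OF M] residue_eq_iff[OF subJ] unfolding J ..
  show "bij_betw g (residue_units J) (V1_ext2 M)"
  proof (rule bij_betw_imageI)
    show "inj_on g (residue_units J)" by (auto simp: inj_on_def residue_units_def eq)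
    have "g ` residue_units J = {g (residue J r) | r. \<exists>s. r * s - 1 \<in> J}"
      by (auto simp: residue_units_def residue_eq_iff[OF subJ])
    also have "\<dots> = V1_ext2 M" unfolding g unfolding V1_ext2_eq[OF M] J ..
    finally show "g ` residue_units J = V1_ext2 M" .
  qed
qed

end

section \<open>The inverse of a two-generated ideal\<close>

lemma to_quot_eq_iff [simp]: "to_quot x = to_quot y \<longleftrightarrow> x = y"
  by transfer (simp add: quotrel_def)

lemma to_quot_diff: "to_quot (x - y) = to_quot x - to_quot y"
  using to_quot_hom(1)[of "x - y" y] by simp

lemma to_quot_0: "to_quot 0 = 0"
  using to_quot_diff[of 0 0] by simp

lemma to_quot_minus: "to_quot (- x) = - to_quot x"
  using to_quot_diff[of 0 x] by (simp add: to_quot_0)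

lemma regular_divide:
  assumes "regular s"
  obtains z where "to_quot s * z = to_quot a"
proof -
  have "to_quot s * abs_total_quot (a, s) = abs_total_quot (s * a, s)"
    unfolding to_quot.abs_eq
    by (subst times_total_quot.abs_eq) (use assms in \<open>simp_all add: quotrel_def\<close>)
  also have "\<dots> = to_quot a"
    unfolding to_quot.abs_eq
    by (rule Quotient_rel_abs[OF Quotient_total_quot])
      (use assms in \<open>simp add: quotrel_def mult.commute\<close>)
  finally show ?thesis by (rule that)
qed

text \<open>A regular element becomes a unit among the fractions, with inverse
  \<open>t\<close>.\<close>

lemma regular_to_quot_cancel:
  assumes "regular s" "to_quot s * x = to_quot s * y"
  shows "x = y"
proof -
  obtain t where "to_quot s * t = to_quot 1"
    using regular_divide[OF assms(1)] by blast
  then have t: "t * to_quot s = 1" by (simp add: to_quot_hom mult.commute)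
  have "x = t * (to_quot s * x)" by (simp add: mult.assoc[symmetric] t)
  also have "\<dots> = y" by (simp add: assms(2)) (simp add: mult.assoc[symmetric] t)
  finally show ?thesis .
qed

text \<open>Membership in the inverse can be tested on the two generators, by linearity.\<close>

lemma ideal_inverseI:
  assumes "to_quot a * z = to_quot p" "to_quot b * z = to_quot q"
  shows "z \<in> ideal_inverse (ring_mod.span {a, b})"
  unfolding ideal_inverse_def
proof clarify
  fix c assume "c \<in> ring_mod.span {a, b}"
  then obtain u v where "c = u * a + v * b" by (auto simp: ring_mod.in_span_pair)
  then have "z * to_quot c = to_quot u * (to_quot a * z) + to_quot v * (to_quot b * z)"
    by (simp add: to_quot_hom algebra_simps)
  also have "\<dots> = to_quot (u * p + v * q)" by (simp add: assms to_quot_hom)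
  finally show "z * to_quot c \<in> range to_quot" by simp
qed

lemma ideal_inverseE:
  assumes "z \<in> ideal_inverse I" "a \<in> I"
  obtains p where "to_quot a * z = to_quot p"
  using assms by (auto simp: ideal_inverse_def mult.commute)

text \<open>The inverse is a submodule, so \<open>(u a + v b) z = a (u z) + b (v z)\<close> brings
  every product, and then every sum of products, into the two-term form.\<close>

lemma ideal_times_inverse_pair:
  assumes I: "I = ring_mod.span {a, b}"
  shows "x \<in> ideal_times_inverse I \<longleftrightarrow>
    (\<exists>z\<in>ideal_inverse I. \<exists>z'\<in>ideal_inverse I. x = to_quot a * z + to_quot b * z')"
proof
  have ab: "a \<in> I" "b \<in> I" by (simp_all add: I ring_mod.span_base)
  have inv_add: "z + z' \<in> ideal_inverse I" if z: "z \<in> ideal_inverse I" "z' \<in> ideal_inverse I" for z z'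
  proof -
    obtain p q p' q' where "to_quot a * z = to_quot p" "to_quot b * z = to_quot q"
      "to_quot a * z' = to_quot p'" "to_quot b * z' = to_quot q'"
      using z ab by (meson ideal_inverseE)
    then show ?thesis unfolding I
      by (intro ideal_inverseI[of _ _ "p + p'" _ "q + q'"]) (simp_all add: distrib_left to_quot_hom)
  qed
  have inv_scale: "to_quot r * z \<in> ideal_inverse I" if z: "z \<in> ideal_inverse I" for r z
  proof -
    obtain p q where pq: "to_quot a * z = to_quot p" "to_quot b * z = to_quot q"
      using z ab by (meson ideal_inverseE)
    have "to_quot a * (to_quot r * z) = to_quot (r * p)" "to_quot b * (to_quot r * z) = to_quot (r * q)"
      unfolding to_quot_hom pq[symmetric] by (rule mult.left_commute)+
    then show ?thesis unfolding I by (rule ideal_inverseI)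
  qed
  have inv_0: "0 \<in> ideal_inverse I"
    unfolding I by (rule ideal_inverseI[of _ _ 0 _ 0]) (simp_all add: to_quot_0)
  let ?T = "{x. \<exists>z\<in>ideal_inverse I. \<exists>z'\<in>ideal_inverse I. x = to_quot a * z + to_quot b * z'}"
  have "ideal_times_inverse I \<subseteq> ?T"
    unfolding ideal_times_inverse_def
  proof (rule quot_mod.span_minimal)
    show "{to_quot c * z | c z. c \<in> I \<and> z \<in> ideal_inverse I} \<subseteq> ?T"
    proof clarify
      fix c z assume c: "c \<in> I" and z: "z \<in> ideal_inverse I"
      obtain u v where uv: "c = u * a + v * b" using c by (auto simp: I ring_mod.in_span_pair)
      show "\<exists>y\<in>ideal_inverse I. \<exists>y'\<in>ideal_inverse I. to_quot c * z = to_quot a * y + to_quot b * y'"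
        by (rule bexI[OF bexI[OF _ inv_scale[OF z, of v]] inv_scale[OF z, of u]])
          (simp add: uv to_quot_hom algebra_simps)
    qed
    show "quot_mod.subspace ?T"
    proof (rule quot_mod.subspaceI)
      show "0 \<in> ?T" using inv_0 by (auto intro!: bexI[of _ 0])
    next
      fix x y assume "x \<in> ?T" "y \<in> ?T"
      then obtain z z' w w' where
        z: "z \<in> ideal_inverse I" "z' \<in> ideal_inverse I" "x = to_quot a * z + to_quot b * z'" and
        w: "w \<in> ideal_inverse I" "w' \<in> ideal_inverse I" "y = to_quot a * w + to_quot b * w'"
        by auto
      then have "x + y = to_quot a * (z + w) + to_quot b * (z' + w')" by (simp add: algebra_simps)
      with inv_add[OF z(1) w(1)] inv_add[OF z(2) w(2)] show "x + y \<in> ?T" by blast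
    next
      fix c x assume "x \<in> ?T"
      then obtain z z' where
        z: "z \<in> ideal_inverse I" "z' \<in> ideal_inverse I" "x = to_quot a * z + to_quot b * z'"
        by auto
      then have "to_quot c * x = to_quot a * (to_quot c * z) + to_quot b * (to_quot c * z')"
        by (simp add: algebra_simps)
      with inv_scale[OF z(1), of c] inv_scale[OF z(2), of c] show "to_quot c * x \<in> ?T" by blast
    qed
  qed
  then show "\<exists>z\<in>ideal_inverse I. \<exists>z'\<in>ideal_inverse I. x = to_quot a * z + to_quot b * z'"
    if "x \<in> ideal_times_inverse I" using that by blast
  assume "\<exists>z\<in>ideal_inverse I. \<exists>z'\<in>ideal_inverse I. x = to_quot a * z + to_quot b * z'"
  then obtain z z' where "z \<in> ideal_inverse I" "z' \<in> ideal_inverse I"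
    and x: "x = to_quot a * z + to_quot b * z'" by blast
  then show "x \<in> ideal_times_inverse I"
    unfolding ideal_times_inverse_def x using ab
    by (intro quot_mod.span_add quot_mod.span_base) blast+
qed

text \<open>A relation \<open>x a + y b = 0\<close> comes from the fraction
  \<open>z = x / b\<close>: then \<open>b z = x\<close> and \<open>a z = - y\<close>, so
  \<open>z\<close> lies in the inverse. Conversely each \<open>z\<close> in the inverse gives a
  relation with coefficients \<open>b z\<close> and \<open>- a z\<close>.\<close>

lemma ideal_times_inverse_eq_relation_coefficients:
  assumes I: "I = ring_mod.span {a, b}" and b: "regular b"
  shows "to_quot ` ring_mod.relation_coefficients a b = ideal_times_inverse I"
proof
  have ab: "a \<in> I" "b \<in> I" by (simp_all add: I ring_mod.span_base)
  let ?J = "ring_mod.relation_coefficients a b"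
  note J = ring_mod.subspace_relation_coefficients[of a b]
  have span: "quot_mod.subspace (ideal_times_inverse I)"
    by (simp add: ideal_times_inverse_def)
  have "?J \<subseteq> {r. to_quot r \<in> ideal_times_inverse I}"
    unfolding ring_mod.relation_coefficients_def
  proof (rule ring_mod.span_minimal)
    show "{r. \<exists>x y. x * a + y * b = 0 \<and> (r = x \<or> r = y)} \<subseteq> {r. to_quot r \<in> ideal_times_inverse I}"
    proof clarify
      fix r x y assume rel: "x * a + y * b = 0" and r: "r = x \<or> r = y"
      obtain z where z: "to_quot b * z = to_quot x" using regular_divide[OF b] by blast
      have "to_quot b * (to_quot a * z) = to_quot a * (to_quot b * z)" by (simp only: mult.left_commute)
      also have "\<dots> = to_quot (x * a)" unfolding z to_quot_hom by (rule mult.commute)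
      also have "x * a = b * - y" using rel by (simp add: add_eq_0_iff2 mult.commute)
      finally have "to_quot b * (to_quot a * z) = to_quot b * to_quot (- y)" by (simp only: to_quot_hom)
      then have az: "to_quot a * z = to_quot (- y)" by (rule regular_to_quot_cancel[OF b])
      have zI: "z \<in> ideal_inverse I" unfolding I by (rule ideal_inverseI[OF az z])
      have "to_quot x \<in> ideal_times_inverse I"
        unfolding ideal_times_inverse_def z[symmetric] using ab zI by (intro quot_mod.span_base) blast
      moreover have "to_quot (- y) \<in> ideal_times_inverse I"
        unfolding ideal_times_inverse_def az[symmetric] using ab zI by (intro quot_mod.span_base) blast
      then have "to_quot y \<in> ideal_times_inverse I"
        using quot_mod.subspace_neg[OF span] by (fastforce simp: to_quot_minus)
      ultimately show "to_quot r \<in> ideal_times_inverse I" using r by blast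
    qed
    show "ring_mod.subspace {r. to_quot r \<in> ideal_times_inverse I}"
      by (rule ring_mod.subspaceI)
        (auto simp: to_quot_0 to_quot_hom intro: quot_mod.subspace_0[OF span]
          quot_mod.subspace_add[OF span] quot_mod.subspace_scale[OF span])
  qed
  then show "to_quot ` ?J \<subseteq> ideal_times_inverse I" by blast
  have coeff: "p \<in> ?J" "q \<in> ?J" if "to_quot a * z = to_quot p" "to_quot b * z = to_quot q" for p q z
  proof -
    \<comment> \<open>Both sides are \<open>a b z\<close> in the total ring of quotients.\<close>
    have "to_quot (q * a) = to_quot (p * b)"
      unfolding to_quot_hom that[symmetric] by (simp only: ac_simps)
    then have "q * a + (- p) * b = 0" by simp
    from ring_mod.relation_coefficientsI[OF this] show "p \<in> ?J" "q \<in> ?J"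
      using ring_mod.subspace_neg[OF J, of "- p"] by auto
  qed
  show "ideal_times_inverse I \<subseteq> to_quot ` ?J"
  proof
    fix x assume "x \<in> ideal_times_inverse I"
    then obtain z z' where z: "z \<in> ideal_inverse I" "z' \<in> ideal_inverse I"
      and x: "x = to_quot a * z + to_quot b * z'"
      by (auto simp: ideal_times_inverse_pair[OF I])
    obtain p q p' q' where pq: "to_quot a * z = to_quot p" "to_quot b * z = to_quot q"
      "to_quot a * z' = to_quot p'" "to_quot b * z' = to_quot q'"
      using z ab by (meson ideal_inverseE)
    have "x = to_quot (p + q')" by (simp add: x pq to_quot_hom)
    moreover have "p + q' \<in> ?J"
      using coeff(1)[OF pq(1,2)] coeff(2)[OF pq(3,4)] by (rule ring_mod.subspace_add[OF J])
    ultimately show "x \<in> to_quot ` ?J" by blast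
  qed
qed

section \<open>Orbits of generating pairs\<close>

context comm_module
begin

lemma row_mult_2:
  assumes "A \<in> carrier_mat 2 2" "j < 2"
  shows "row_mult m A $ j = scale (A $$ (0, j)) (m $ 0) + scale (A $$ (1, j)) (m $ 1)"
  using assms by (simp add: row_mult_index numeral_2_eq_2)

lemma wedge_row_mult:
  assumes m: "m \<in> V 2 M" and A: "A \<in> carrier_mat 2 2"
  shows "wedge M (row_mult m A $ 0) (row_mult m A $ 1) = ext2_scale M (det A) (wedge M (m $ 0) (m $ 1))"
  using wedge_combination[OF V_2D(2)[OF m]] A
  by (simp add: row_mult_2 det_carrier_2 mult.commute)

text \<open>Determinant one in \<open>wedge_row_mult\<close>; this makes the wedge a function of the
  orbit.\<close>

lemma wedge_SL_orbit:
  assumes "m \<in> V 2 M" "n \<in> SL_orbit m"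
  shows "wedge M (n $ 0) (n $ 1) = wedge M (m $ 0) (m $ 1)"
  using assms wedge_row_mult[OF assms(1)] V_2D(1)[OF assms(1)]
  by (auto simp: SL_orbit_def ext2_scale_one)

lemma mem_SL_orbit: "m \<in> SL_orbit m"
  unfolding SL_orbit_def
  by (intro CollectI exI[of _ "1\<^sub>m (dim_vec m)"]) (simp add: row_mult_one)

text \<open>By multiplicativity of the determinant. Equality of orbits then follows from membership
  in both directions, without inverse matrices.\<close>

lemma SL_orbit_mono:
  assumes "n \<in> SL_orbit m"
  shows "SL_orbit n \<subseteq> SL_orbit m"
proof
  fix v assume "v \<in> SL_orbit n"
  with assms obtain A B where A: "A \<in> carrier_mat (dim_vec m) (dim_vec m)" "det A = 1" "n = row_mult m A"
    and B: "B \<in> carrier_mat (dim_vec m) (dim_vec m)" "det B = 1" "v = row_mult n B"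
    by (auto simp: SL_orbit_def)
  have "v = row_mult m (A * B)" using A B by (simp add: row_mult_mult)
  moreover have "det (A * B) = 1" using det_mult[OF A(1) B(1)] A B by simp
  ultimately show "v \<in> SL_orbit m"
    unfolding SL_orbit_def using A B by (intro CollectI exI[of _ "A * B"]) auto
qed

end

text \<open>Here \<open>det A - 1 = c z' + d z\<close> with \<open>z, z' \<in> I\<^sup>-\<^sup>1\<close>, since \<open>c\<close> and \<open>d\<close> generate \<open>I\<close> as well; adding
  the relations \<open>(-b z, a z)\<close> and \<open>(b z', -a z')\<close> to the columns of \<open>A\<close> corrects the determinant.\<close>

lemma wedge_eq_imp_SL_orbit:
  assumes fitt: "to_quot ` ring_mod.fitting_ideal 1 I = ideal_times_inverse I"
    and m: "m \<in> ring_mod.V 2 I" and n: "n \<in> ring_mod.V 2 I"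
    and wedge: "ring_mod.wedge I (m $ 0) (m $ 1) = ring_mod.wedge I (n $ 0) (n $ 1)"
  shows "n \<in> ring_mod.SL_orbit m"
proof -
  define a b c d where "a = m $ 0" and "b = m $ 1" and "c = n $ 0" and "d = n $ 1"
  have I: "I = ring_mod.span {a, b}" "I = ring_mod.span {c, d}"
    using ring_mod.V_2D m n by (auto simp: a_def b_def c_def d_def)
  have ab: "a \<in> I" "b \<in> I" by (simp_all add: I(1) ring_mod.span_base)
  have "c \<in> I" "d \<in> I" by (simp_all add: I(2) ring_mod.span_base)
  then obtain \<alpha> \<beta> \<gamma> \<delta> where c: "c = \<alpha> * a + \<beta> * b" and d: "d = \<gamma> * a + \<delta> * b"
    by (auto simp: I(1) ring_mod.in_span_pair)
  \<comment> \<open>Both sides equal \<open>c \<and> d\<close>, the left one by the determinant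
    formula and the right one by \<open>wedge\<close>. So the determinant is \<open>1\<close> modulo
    the annihilator of \<open>a \<and> b\<close>, which is the Fitting ideal.\<close>
  have "ring_mod.ext2_scale I (\<alpha> * \<delta> - \<beta> * \<gamma>) (ring_mod.wedge I a b) =
      ring_mod.ext2_scale I 1 (ring_mod.wedge I a b)"
    using wedge ring_mod.wedge_combination[OF I(1), of \<alpha> \<beta> \<gamma> \<delta>]
    unfolding ring_mod.ext2_scale_one a_def[symmetric] b_def[symmetric] c_def[symmetric]
      d_def[symmetric] c[symmetric] d[symmetric] by simp
  then have "\<alpha> * \<delta> - \<beta> * \<gamma> - 1 \<in> ring_mod.fitting_ideal 1 I"
    using ring_mod.fitting_ideal_1_pair[OF m] ring_mod.ext2_scale_wedge_eq_iff[OF I(1)]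
    by (simp add: a_def b_def)
  then have "to_quot (\<alpha> * \<delta> - \<beta> * \<gamma> - 1) \<in> ideal_times_inverse I"
    using fitt by blast
  then obtain z' z where z: "z' \<in> ideal_inverse I" "z \<in> ideal_inverse I"
    and det: "to_quot (\<alpha> * \<delta> - \<beta> * \<gamma> - 1) = to_quot c * z' + to_quot d * z"
    by (auto simp: ideal_times_inverse_pair[OF I(2)])
  obtain p q p' q' where pq: "to_quot a * z = to_quot p" "to_quot b * z = to_quot q"
    "to_quot a * z' = to_quot p'" "to_quot b * z' = to_quot q'"
    using z ab by (meson ideal_inverseE)
  \<comment> \<open>The common values are \<open>a b z\<close>, \<open>a b z'\<close> and
    \<open>a b z z'\<close>. The first two equations make \<open>(- q, p)\<close> and
    \<open>(q', - p')\<close> relations of \<open>a\<close> and \<open>b\<close>.\<close>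
  have "to_quot (a * q) = to_quot (b * p)" "to_quot (a * q') = to_quot (b * p')"
    "to_quot (p * q') = to_quot (p' * q)"
    unfolding to_quot_hom pq[symmetric] by (simp_all only: ac_simps)
  then have rel: "a * q = b * p" "a * q' = b * p'" "p * q' = p' * q" by simp_all
  have "to_quot c * z' + to_quot d * z =
      to_quot \<alpha> * (to_quot a * z') + to_quot \<beta> * (to_quot b * z') +
      (to_quot \<gamma> * (to_quot a * z) + to_quot \<delta> * (to_quot b * z))"
    by (simp add: c d to_quot_hom algebra_simps)
  also have "\<dots> = to_quot (\<alpha> * p' + \<beta> * q' + (\<gamma> * p + \<delta> * q))"
    by (simp add: pq to_quot_hom)
  finally have det': "\<alpha> * \<delta> - \<beta> * \<gamma> - 1 = \<alpha> * p' + \<beta> * q' + (\<gamma> * p + \<delta> * q)"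
    using det by simp
  define A where "A = mat 2 2 (\<lambda>(i, j).
    if i = 0 then if j = 0 then \<alpha> - q else \<gamma> + q' else if j = 0 then \<beta> + p else \<delta> - p')"
  have A: "A \<in> carrier_mat 2 2" by (simp add: A_def)
  \<comment> \<open>The linear correction equals the old determinant minus \<open>1\<close> by
    \<open>det'\<close>, and the quadratic term vanishes by the third equation of
    \<open>rel\<close>.\<close>
  have "det A = (\<alpha> * \<delta> - \<beta> * \<gamma>) - (\<alpha> * p' + \<beta> * q' + (\<gamma> * p + \<delta> * q)) + (p' * q - p * q')"
    by (simp add: det_carrier_2[OF A]) (simp add: A_def algebra_simps)
  also have "\<dots> = 1" by (simp add: rel det'[symmetric])
  finally have detA: "det A = 1" .
  have "n = ring_mod.row_mult m A"
  proof (rule eq_vecI)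
    fix j assume "j < dim_vec (ring_mod.row_mult m A)"
    then consider "j = 0" | "j = 1" using A by fastforce
    then show "n $ j = ring_mod.row_mult m A $ j"
    proof cases
      case 1
      have "ring_mod.row_mult m A $ 0 = (\<alpha> - q) * a + (\<beta> + p) * b"
        using ring_mod.row_mult_2[OF A, of 0 m] by (simp add: A_def a_def b_def)
      also have "\<dots> = c" using rel by (simp add: c algebra_simps)
      finally show ?thesis by (simp add: 1 c_def)
    next
      case 2
      have "ring_mod.row_mult m A $ 1 = (\<gamma> + q') * a + (\<delta> - p') * b"
        using ring_mod.row_mult_2[OF A, of 1 m] by (simp add: A_def a_def b_def)
      also have "\<dots> = d" using rel by (simp add: d algebra_simps)
      finally show ?thesis by (simp add: 2 d_def)
    qed
  qed (simp add: A_def ring_mod.V_2D[OF n])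
  then show ?thesis
    unfolding ring_mod.SL_orbit_def using A detA ring_mod.V_2D(1)[OF m] by auto
qed

theorem theorem1p1:
  fixes I :: "'a::comm_ring_1 set"
  assumes "two_generated I"
  shows
    "(to_quot ` ring_mod.fitting_ideal 1 I = ideal_times_inverse I \<longrightarrow>
       (\<exists>f. (\<forall>m \<in> ring_mod.V 2 I. f (ring_mod.SL_orbit m) = ring_mod.wedge I (m $ 0) (m $ 1)) \<and>
            f ` (ring_mod.SL_orbit ` ring_mod.V 2 I) \<subseteq> ring_mod.V1_ext2 I \<and>
            inj_on f (ring_mod.SL_orbit ` ring_mod.V 2 I))) \<and>
     ((\<exists>a b. regular a \<and> regular b \<and> I = ring_mod.span {a, b}) \<longrightarrow>
       to_quot ` ring_mod.fitting_ideal 1 I = ideal_times_inverse I) \<and>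
     (\<forall>m \<in> ring_mod.V 2 I.
       \<exists>g. (\<forall>r. residue (ring_mod.fitting_ideal 1 I) r \<in> residue_units (ring_mod.fitting_ideal 1 I) \<longrightarrow>
               g (residue (ring_mod.fitting_ideal 1 I) r) =
                 ring_mod.ext2_scale I r (ring_mod.wedge I (m $ 0) (m $ 1))) \<and>
           bij_betw g (residue_units (ring_mod.fitting_ideal 1 I)) (ring_mod.V1_ext2 I))"
proof (intro conjI impI ballI)
  assume fitt: "to_quot ` ring_mod.fitting_ideal 1 I = ideal_times_inverse I"
  \<comment> \<open>The wedge is evaluated on a chosen representative of the orbit.\<close>
  define f where "f \<omega> = (let m = SOME m. m \<in> ring_mod.V 2 I \<and> ring_mod.SL_orbit m = \<omega>
    in ring_mod.wedge I (m $ 0) (m $ 1))" for \<omega> :: "'a vec set"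
  have f: "f (ring_mod.SL_orbit m) = ring_mod.wedge I (m $ 0) (m $ 1)" if m: "m \<in> ring_mod.V 2 I" for m
  proof -
    define n where "n = (SOME n. n \<in> ring_mod.V 2 I \<and> ring_mod.SL_orbit n = ring_mod.SL_orbit m)"
    have "n \<in> ring_mod.V 2 I \<and> ring_mod.SL_orbit n = ring_mod.SL_orbit m"
      unfolding n_def by (rule someI) (use m in simp)
    \<comment> \<open>The representative \<open>n\<close> lies in its own orbit, hence in that of
      \<open>m\<close>, where the wedge is constant.\<close>
    then have "ring_mod.wedge I (n $ 0) (n $ 1) = ring_mod.wedge I (m $ 0) (m $ 1)"
      using ring_mod.wedge_SL_orbit[OF m, of n] ring_mod.mem_SL_orbit[of n] by simp
    then show ?thesis by (simp add: f_def n_def Let_def)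
  qed
  show "\<exists>f. (\<forall>m \<in> ring_mod.V 2 I. f (ring_mod.SL_orbit m) = ring_mod.wedge I (m $ 0) (m $ 1)) \<and>
      f ` (ring_mod.SL_orbit ` ring_mod.V 2 I) \<subseteq> ring_mod.V1_ext2 I \<and>
      inj_on f (ring_mod.SL_orbit ` ring_mod.V 2 I)"
  proof (intro exI[of _ f] conjI ballI f)
    show "f ` (ring_mod.SL_orbit ` ring_mod.V 2 I) \<subseteq> ring_mod.V1_ext2 I"
    proof clarify
      fix m assume m: "m \<in> ring_mod.V 2 I"
      \<comment> \<open>The wedge of a generating pair is \<open>1\<close> times itself, and
        \<open>1\<close> is invertible modulo any ideal.\<close>
      have "ring_mod.ext2_scale I 1 (ring_mod.wedge I (m $ 0) (m $ 1)) \<in> ring_mod.V1_ext2 I"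
        unfolding ring_mod.V1_ext2_eq[OF ring_mod.V_2D(2)[OF m]]
        by (intro CollectI exI[of _ 1] conjI refl)
          (simp add: ring_mod.subspace_0[OF ring_mod.subspace_relation_coefficients])
      then show "f (ring_mod.SL_orbit m) \<in> ring_mod.V1_ext2 I"
        by (simp add: f[OF m] ring_mod.ext2_scale_one)
    qed
    show "inj_on f (ring_mod.SL_orbit ` ring_mod.V 2 I)"
    proof (rule inj_onI, clarify)
      fix m n assume m: "m \<in> ring_mod.V 2 I" and n: "n \<in> ring_mod.V 2 I"
        and "f (ring_mod.SL_orbit m) = f (ring_mod.SL_orbit n)"
      then have "ring_mod.wedge I (m $ 0) (m $ 1) = ring_mod.wedge I (n $ 0) (n $ 1)"
        by (simp add: f)
      \<comment> \<open>Equal wedges put each pair in the orbit of the other, which gives both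
        inclusions.\<close>
      then show "ring_mod.SL_orbit m = ring_mod.SL_orbit n"
        by (intro equalityI ring_mod.SL_orbit_mono wedge_eq_imp_SL_orbit[OF fitt] m n) simp_all
    qed
  qed
next
  assume "\<exists>a b. regular a \<and> regular b \<and> I = ring_mod.span {a, b}"
  then obtain a b where b: "regular b" and I: "I = ring_mod.span {a, b}" by blast
  have "ring_mod.fitting_ideal 1 I = ring_mod.relation_coefficients a b"
    using ring_mod.fitting_ideal_1_pair[OF ring_mod.span_pair_in_V_2[of a b]] by (simp add: I)
  then show "to_quot ` ring_mod.fitting_ideal 1 I = ideal_times_inverse I"
    using ideal_times_inverse_eq_relation_coefficients[OF I b] by simp
next
  fix m assume m: "m \<in> ring_mod.V 2 I"
  show "\<exists>g. (\<forall>r. residue (ring_mod.fitting_ideal 1 I) r \<in> residue_units (ring_mod.fitting_ideal 1 I) \<longrightarrow>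
        g (residue (ring_mod.fitting_ideal 1 I) r) =
          ring_mod.ext2_scale I r (ring_mod.wedge I (m $ 0) (m $ 1))) \<and>
      bij_betw g (residue_units (ring_mod.fitting_ideal 1 I)) (ring_mod.V1_ext2 I)"
    by (rule ring_mod.residue_units_bij_V1_ext2[OF ring_mod.V_2D(2)[OF m] ring_mod.fitting_ideal_1_pair[OF m]])
qed

end
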